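(* Let $q$ be a real number with $0<q<1$. For any index $\bm{k}=(k_1,\ldots,k_r)$, with reversal $\overleftarrow{\bm{k}}=(k_r,k_{r-1},\ldots,k_1)$, the equality $$F^{q}_{\bm{k}}(z)=G^{q}_{\overleftarrow{\bm{k}}}(z)$$ holds for every complex number $z$ with $|z|<q^{-1}$.
   Context: An index is a (nonempty, finite) tuple of positive integers. Throughout, $q$ is a fixed real constant with $0<q<1$, and for an integer $m$, $[m]=(1-q^m)/(1-q)$. Empty products equal $1$. Hoffman dual. Write an index $\bm{k}$ in the form $\bm{k}=(1\,\square\,1\,\square\cdots\square\,1)$ (with $k_1+\cdots+k_r$ ones), where each $\square$ is either a plus symbol $+$ or a comma. The Hoffman dual $\bm{k}^{\vee}$ is the index obtained by changing every $+$ to a comma and every comma to $+$. For example, $(2,1,3,2)=(1+1,1,1+1+1,1+1)$ has $\bm{k}^\vee=(1,1+1+1,1,1+1,1)=(1,3,1,2,1)$. The function $F^q_{\bm{k}}$. Let $\bm{k}^\vee=(k_1',\ldots,k_s')$. For complex $z$ with $|z|<q^{-1}$, $$F^q_{\bm{k}}(z)=-\sum_{0<m_1\le\cdots\le m_s}\left(\prod_{a=1}^{s-1}\frac{q^{(k_a'-1)m_a}}{[m_a]^{k_a'}}\right)\frac{q^{k_s'm_s}}{[m_s]^{k_s'}}\prod_{j=1}^{m_s}\frac{z-q^{j-1}}{1-q^j},$$ the sum being over integers $m_1,\ldots,m_s$ (it converges absolutely). The function $G^q_{\bm{k}}$. For an integer $m$ set $[m+\log_q z]=\dfrac{1-zq^m}{1-q}$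 (this is just notation; no logarithm is needed). For an index $\bm{k}=(k_1,\ldots,k_r)$ and complex $z$ with $|z|<q^{-1}$, $$G^q_{\bm{k}}(z)=\sum\left\{\prod_{j=1}^{r-1}\left(\prod_{l=1}^{k_j-1}\frac{1}{[m_{j,l}+\log_q z]}\right)\frac{1}{[m_{j,k_j}]}\right\}\left(\prod_{l=1}^{k_r-1}\frac{1}{[m_{r,l}+\log_q z]}\right)\left(\frac{q^{m_{r,k_r}}}{[m_{r,k_r}]}-\frac{q^{m_{r,k_r}}z}{[m_{r,k_r}+\log_q z]}\right),$$ where the sum is over all integers $m_{j,l}$ ($1\le j\le r$, $1\le l\le k_j$) satisfying $$0<m_{1,1}\le\cdots\le m_{1,k_1}<m_{2,1}\le\cdots\le m_{2,k_2}<\cdots<m_{r,1}\le\cdots\le m_{r,k_r}$$ (it converges absolutely). *)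

theory Defs
  imports "HOL-Analysis.Analysis"
begin

definition is_index :: "nat list \<Rightarrow> bool" where
  "is_index k \<longleftrightarrow> k \<noteq> [] \<and> (\<forall>n\<in>set k. 0 < n)"

datatype box = Plus | Comma

text \<open>
  An index of weight \<open>w\<close> is written \<open>(1 \<box> 1 \<box> \<dots> \<box> 1)\<close> with \<open>w\<close> ones; it is encoded by the list
  of its \<open>w - 1\<close> separators. The functions \<open>boxes\<close> and \<open>of_boxes\<close> translate between the two forms.
\<close>

fun boxes :: "nat list \<Rightarrow> box list" where
  "boxes [] = []"
| "boxes [n] = replicate (n - 1) Plus"
| "boxes (n # n' # ns) = replicate (n - 1) Plus @ Comma # boxes (n' # ns)"

fun of_boxes :: "box list \<Rightarrow> nat list" where
  "of_boxes [] = [1]"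
| "of_boxes (Plus # bs) = Suc (hd (of_boxes bs)) # tl (of_boxes bs)"
| "of_boxes (Comma # bs) = 1 # of_boxes bs"

fun swap_box :: "box \<Rightarrow> box" where
  "swap_box Plus = Comma"
| "swap_box Comma = Plus"

definition hoffman_dual :: "nat list \<Rightarrow> nat list" where
  "hoffman_dual k = of_boxes (map swap_box (boxes k))"

lemma of_boxes_replicate_Plus:
  "of_boxes (replicate i Plus @ bs) = (i + hd (of_boxes bs)) # tl (of_boxes bs)"
proof (induction i)
  case 0
  have "of_boxes bs \<noteq> []"
    by (cases bs rule: of_boxes.cases) auto
  then show ?case by simp
qed auto

lemma of_boxes_boxes: "is_index k \<Longrightarrow> of_boxes (boxes k) = k"
proof (induction k rule: boxes.induct)
  case (2 n)
  then show ?case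
    using of_boxes_replicate_Plus[of "n - 1" "[]"] by (simp add: is_index_def)
qed (auto simp: is_index_def of_boxes_replicate_Plus)

lemma "hoffman_dual [2, 1, 3, 2] = [1, 3, 1, 2, 1]"
  by (simp add: hoffman_dual_def numeral_eq_Suc)

text \<open>
  Only positive \<open>m\<close> occur in the series below, so \<open>[m]\<close> and \<open>[m + log_q z]\<close> are taken for
  natural \<open>m\<close>.
\<close>

definition q_bracket :: "real \<Rightarrow> nat \<Rightarrow> real" where
  "q_bracket q m = (1 - q ^ m) / (1 - q)"

definition q_bracket_log :: "real \<Rightarrow> complex \<Rightarrow> nat \<Rightarrow> complex" where
  "q_bracket_log q z m = (1 - z * of_real q ^ m) / (1 - of_real q)"

text \<open>
  Lists are indexed from \<open>0\<close>: the entry \<open>m_a\<close> of a tuple is \<open>ms ! (a - 1)\<close>, and the entry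
  \<open>m_{j,l}\<close> of a family of tuples is \<open>M ! (j - 1) ! (l - 1)\<close>.
\<close>

definition F_tuples :: "nat \<Rightarrow> nat list set" where
  "F_tuples s = {ms. length ms = s \<and> sorted ms \<and> (\<forall>m\<in>set ms. 0 < m)}"

definition F_term :: "real \<Rightarrow> nat list \<Rightarrow> complex \<Rightarrow> nat list \<Rightarrow> complex" where
  "F_term q k' z ms = (let s = length k' in
     (\<Prod>a<s - 1. of_real (q ^ ((k' ! a - 1) * ms ! a) / q_bracket q (ms ! a) ^ (k' ! a)))
     * of_real (q ^ (k' ! (s - 1) * ms ! (s - 1)) / q_bracket q (ms ! (s - 1)) ^ (k' ! (s - 1)))
     * (\<Prod>j = 1..ms ! (s - 1). (z - of_real q ^ (j - 1)) / (1 - of_real q ^ j)))"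

definition F :: "real \<Rightarrow> nat list \<Rightarrow> complex \<Rightarrow> complex" where
  "F q k z = - (\<Sum>\<^sub>\<infinity>ms\<in>F_tuples (length (hoffman_dual k)). F_term q (hoffman_dual k) z ms)"

definition G_tuples :: "nat list \<Rightarrow> nat list list set" where
  "G_tuples k = {M. map length M = k
     \<and> (\<forall>ms\<in>set M. sorted ms \<and> (\<forall>m\<in>set ms. 0 < m))
     \<and> (\<forall>j. Suc j < length M \<longrightarrow> last (M ! j) < hd (M ! Suc j))}"

definition G_term :: "real \<Rightarrow> nat list \<Rightarrow> complex \<Rightarrow> nat list list \<Rightarrow> complex" where
  "G_term q k z M = (let r = length k; m = M ! (r - 1) ! (k ! (r - 1) - 1) in
     (\<Prod>j<r - 1. (\<Prod>l<k ! j - 1. 1 / q_bracket_log q z (M ! j ! l))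
                  * (1 / of_real (q_bracket q (M ! j ! (k ! j - 1)))))
     * (\<Prod>l<k ! (r - 1) - 1. 1 / q_bracket_log q z (M ! (r - 1) ! l))
     * (of_real (q ^ m) / of_real (q_bracket q m)
        - of_real (q ^ m) * z / q_bracket_log q z m))"

definition G :: "real \<Rightarrow> nat list \<Rightarrow> complex \<Rightarrow> complex" where
  "G q k z = (\<Sum>\<^sub>\<infinity>M\<in>G_tuples k. G_term q k z M)"

end

theory Submission
  imports Defs
begin

text \<open>
  Connected sums in the sense of Seki and Yamamoto. Put
  \<open>P\<^sub>n = \<Prod>\<^sub>j\<^sub>\<le>\<^sub>n (z - q\<^sup>j\<^sup>-\<^sup>1) / (1 - q\<^sup>j)\<close> and take the connector
  \<open>C(n, m) = q\<^sup>n\<^sup>m (q;q)\<^sub>n (q;q)\<^sub>m / (q;q)\<^sub>n\<^sub>+\<^sub>m P\<^sub>n\<close>, so that \<open>C(n, 0) = P\<^sub>n\<close>. Telescoping gives, for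
  \<open>n, a > 0\<close>,
  \<open>q\<^sup>n / [n] C(n, m) = \<Sum>\<^sub>i\<^sub>>\<^sub>m C(n, i) / [i]\<close> and
  \<open>\<Sum>\<^sub>n\<^sub>\<ge>\<^sub>a q\<^sup>n / [n] C(n, m) = \<Sum>\<^sub>i\<^sub>>\<^sub>m q\<^sup>a C(a, i - 1) / [i + log\<^sub>q z]\<close>.
  Starting from the outermost variable of \<open>F\<close>, each of these removes one factor \<open>q\<^sup>n / [n]\<close> on the \<open>F\<close>
  side and creates the next smallest variable on the \<open>G\<close> side: the first acts at a plus of the
  Hoffman dual (a comma of the index) and yields a strict inequality, the second acts at a comma of
  the dual (a plus of the index) and yields a weak one.
\<close>

subsection \<open>Hoffman duals\<close>

text \<open>In box form, every index other than \<open>[1]\<close> arises from one of smaller weight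
  by prefixing \<open>1,\<close> or \<open>1+\<close>. The two cases correspond to the two moves of
  the connected sum.\<close>

lemma index_induct [consumes 1, case_names one comma plus]:
  assumes "is_index k"
    and one: "P [Suc 0]"
    and comma: "\<And>k ks. is_index (k # ks) \<Longrightarrow> P (k # ks) \<Longrightarrow> P (Suc 0 # k # ks)"
    and plus: "\<And>k ks. is_index (Suc k # ks) \<Longrightarrow> P (Suc k # ks) \<Longrightarrow> P (Suc (Suc k) # ks)"
  shows "P k"
  using assms(1)
proof (induction "sum_list k" arbitrary: k rule: less_induct)
  case less
  then obtain c ks where k: "k = Suc c # ks"
    by (cases k) (auto simp: is_index_def gr0_conv_Suc)
  show ?case
  proof (cases c)
    case (Suc c')
    then have "is_index (Suc c' # ks)" "sum_list (Suc c' # ks) < sum_list k"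
      using less.prems k by (auto simp: is_index_def)
    then show ?thesis
      using less.hyps plus k Suc by blast
  next
    case 0
    show ?thesis
    proof (cases ks)
      case Nil
      then show ?thesis using one k 0 by simp
    next
      case (Cons k' ks')
      then have "is_index (k' # ks')" "sum_list (k' # ks') < sum_list k"
        using less.prems k by (auto simp: is_index_def)
      then show ?thesis
        using less.hyps comma k 0 Cons by auto
    qed
  qed
qed

lemma of_boxes_ne [simp]: "of_boxes bs \<noteq> []"
  by (cases bs rule: of_boxes.cases) auto

lemma is_index_of_boxes: "is_index (of_boxes bs)"
proof (induction bs rule: of_boxes.induct)
  case (2 bs)
  then show ?case
    by (cases "of_boxes bs") (auto simp: is_index_def)
qed (auto simp: is_index_def)

lemma is_index_hoffman_dual: "is_index (hoffman_dual k)"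
  by (simp add: hoffman_dual_def is_index_of_boxes)

text \<open>Positivity of \<open>k\<close> matters: \<open>n - 1\<close> on naturals gives the
  entries 0 and 1 the same boxes.\<close>

lemma boxes_append_Plus:
  "0 < k \<Longrightarrow> boxes (ks @ [Suc k]) = boxes (ks @ [k]) @ [Plus]"
proof (induction ks rule: boxes.induct)
  case 1
  then show ?case
    by (cases k) (auto simp flip: replicate_append_same)
next
  case (2 n)
  then show ?case
    by (cases k) (auto simp flip: replicate_append_same)
qed auto

lemma boxes_append_Comma:
  "ks \<noteq> [] \<Longrightarrow> boxes (ks @ [1]) = boxes ks @ [Comma]"
  by (induction ks rule: boxes.induct) auto

lemma of_boxes_append_Comma: "of_boxes (bs @ [Comma]) = of_boxes bs @ [1]"
  by (induction bs rule: of_boxes.induct) auto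

lemma of_boxes_append_Plus:
  "of_boxes bs = ks @ [k] \<Longrightarrow> of_boxes (bs @ [Plus]) = ks @ [Suc k]"
proof (induction bs arbitrary: ks k rule: of_boxes.induct)
  case (2 bs)
  obtain ks' k' where *: "of_boxes bs = ks' @ [k']"
    by (metis of_boxes_ne rev_exhaust)
  then show ?case
    \<comment> \<open>The case splits separate off the one-entry index, where the head raised by the
      leading plus is also the last entry.\<close>
    using "2.IH"[of ks' k'] "2.prems" by (cases ks'; cases ks) auto
next
  case (3 bs)
  obtain ks' k' where *: "of_boxes bs = ks' @ [k']"
    by (metis of_boxes_ne rev_exhaust)
  then show ?case
    using "3.IH"[of ks' k'] "3.prems" by auto
qed auto

lemma hoffman_dual_one: "hoffman_dual [Suc 0] = [Suc 0]"
  by (simp add: hoffman_dual_def)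

text \<open>A plus added at the right end of the box form becomes a comma in the dual and so opens a
  new last entry; in the next lemma an added comma becomes a plus and raises the last entry.\<close>

lemma hoffman_dual_append_Suc:
  "hoffman_dual (ks @ [Suc (Suc k)]) = hoffman_dual (ks @ [Suc k]) @ [Suc 0]"
  by (simp add: hoffman_dual_def boxes_append_Plus of_boxes_append_Comma)

lemma hoffman_dual_append_one:
  "ks \<noteq> [] \<Longrightarrow> hoffman_dual ks = ks' @ [k] \<Longrightarrow> hoffman_dual (ks @ [Suc 0]) = ks' @ [Suc k]"
  using boxes_append_Comma[of ks] by (simp add: hoffman_dual_def of_boxes_append_Plus)

subsection \<open>Truncations of the two families of tuples\<close>

text \<open>This is \<open>F_term\<close> without the product over \<open>j\<close>, its only factor
  that involves \<open>z\<close>. What is left is real and, for \<open>0 < q < 1\<close> on the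
  tuples summed over, nonnegative.\<close>

definition F_weight :: "real \<Rightarrow> nat list \<Rightarrow> nat list \<Rightarrow> real" where
  "F_weight q k' ms = (let s = length k' in
     (\<Prod>a<s - 1. q ^ ((k' ! a - 1) * ms ! a) / q_bracket q (ms ! a) ^ (k' ! a))
     * (q ^ (k' ! (s - 1) * ms ! (s - 1)) / q_bracket q (ms ! (s - 1)) ^ (k' ! (s - 1))))"

lemma F_weight_snoc:
  assumes "length ms = length k'"
  shows "F_weight q (k' @ [k]) (ms @ [m]) =
    (\<Prod>a<length k'. q ^ ((k' ! a - 1) * ms ! a) / q_bracket q (ms ! a) ^ (k' ! a))
    * (q ^ (k * m) / q_bracket q m ^ k)"
  using assms by (simp add: F_weight_def nth_append)

lemma F_weight_snoc_Suc:
  assumes "length ms = length k'"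
  shows "F_weight q (k' @ [Suc k]) (ms @ [m]) =
    q ^ m / q_bracket q m * F_weight q (k' @ [k]) (ms @ [m])"
  by (simp add: F_weight_snoc[OF assms] power_add)

text \<open>The last variable carries the exponent \<open>k * m\<close>, an inner one only
  \<open>(k - 1) * m\<close>. Division by \<open>q ^ m\<close> accounts for \<open>m\<close> losing
  its place as last variable.\<close>

lemma F_weight_snoc_one:
  assumes "length ms = length k'" "0 < k" "0 < q"
  shows "F_weight q (k' @ [k, Suc 0]) (ms @ [m, n]) =
    q ^ n / q_bracket q n * (F_weight q (k' @ [k]) (ms @ [m]) / q ^ m)"
proof -
  have "q ^ (k * m) = q ^ ((k - 1) * m) * q ^ m"
    using assms by (cases k) (auto simp: power_add)
  then show ?thesis
    using assms F_weight_snoc[of "ms @ [m]" "k' @ [k]" q "Suc 0" n]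
    by (simp add: F_weight_snoc nth_append mult_ac)
qed

text \<open>Fixing the last, hence largest, entry leaves only finitely many tuples, so the sum over
  each fibre is finite.\<close>

definition F_tuples_last :: "nat \<Rightarrow> nat \<Rightarrow> nat list set" where
  "F_tuples_last s n = {ms \<in> F_tuples s. last ms = n}"

lemma finite_F_tuples_last: "finite (F_tuples_last (Suc s) n)"
proof (rule finite_subset)
  show "F_tuples_last (Suc s) n \<subseteq> {ms. set ms \<subseteq> {..n} \<and> length ms = Suc s}"
  proof
    fix ms assume "ms \<in> F_tuples_last (Suc s) n"
    then obtain ms' where "ms = ms' @ [n]" "length ms = Suc s" "sorted ms"
      by (cases ms rule: rev_cases) (auto simp: F_tuples_last_def F_tuples_def)
    then show "ms \<in> {ms. set ms \<subseteq> {..n} \<and> length ms = Suc s}"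
      by (auto simp: sorted_append)
  qed
qed (auto intro: finite_lists_length_eq)

lemma F_tuples_last_one: "0 < n \<Longrightarrow> F_tuples_last (Suc 0) n = {[n]}"
  by (auto simp: F_tuples_last_def F_tuples_def length_Suc_conv)

lemma F_tuples_last_Suc:
  assumes "0 < n"
  shows "F_tuples_last (Suc (Suc s)) n = (\<lambda>ms. ms @ [n]) ` (\<Union>a\<in>{1..n}. F_tuples_last (Suc s) a)"
proof (intro equalityI subsetI)
  fix ms assume ms: "ms \<in> F_tuples_last (Suc (Suc s)) n"
  then obtain ms' where ms': "ms = ms' @ [n]"
    by (cases ms rule: rev_cases) (auto simp: F_tuples_last_def F_tuples_def)
  then obtain ms'' a where "ms' = ms'' @ [a]"
    using ms by (cases ms' rule: rev_cases) (auto simp: F_tuples_last_def F_tuples_def)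
  then have "ms' \<in> F_tuples_last (Suc s) a" "a \<in> {1..n}"
    using ms ms' by (auto simp: F_tuples_last_def F_tuples_def sorted_append Suc_le_eq)
  then show "ms \<in> (\<lambda>ms. ms @ [n]) ` (\<Union>a\<in>{1..n}. F_tuples_last (Suc s) a)"
    using ms' by blast
next
  fix ms assume "ms \<in> (\<lambda>ms. ms @ [n]) ` (\<Union>a\<in>{1..n}. F_tuples_last (Suc s) a)"
  then obtain ms' a where *: "ms = ms' @ [n]" "ms' \<in> F_tuples_last (Suc s) a" "1 \<le> a" "a \<le> n"
    by auto
  then obtain ms'' where "ms' = ms'' @ [a]"
    by (cases ms' rule: rev_cases) (auto simp: F_tuples_last_def F_tuples_def)
  then show "ms \<in> F_tuples_last (Suc (Suc s)) n"
    using * assms by (auto simp: F_tuples_last_def F_tuples_def sorted_append)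
qed

text \<open>Grouping the series of \<open>F\<close> by its largest variable \<open>n\<close> makes
  this the coefficient of the product \<open>P n\<close>, up to the sign in
  \<open>F\<close>.\<close>

definition F_coeff :: "real \<Rightarrow> nat list \<Rightarrow> nat \<Rightarrow> real" where
  "F_coeff q k' n = (\<Sum>ms\<in>F_tuples_last (length k') n. F_weight q k' ms)"

lemma F_coeff_one: "0 < n \<Longrightarrow> F_coeff q [Suc 0] n = q ^ n / q_bracket q n"
  by (simp add: F_coeff_def F_tuples_last_one F_weight_def)

lemma F_tuples_last_decomp:
  assumes "ms \<in> F_tuples_last (Suc s) n"
  obtains ms' where "ms = ms' @ [n]" "length ms' = s"
  using assms by (cases ms rule: rev_cases) (auto simp: F_tuples_last_def F_tuples_def)

lemma F_coeff_snoc_Suc: "F_coeff q (k' @ [Suc k]) n = q ^ n / q_bracket q n * F_coeff q (k' @ [k]) n"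
proof -
  have "F_weight q (k' @ [Suc k]) ms = q ^ n / q_bracket q n * F_weight q (k' @ [k]) ms"
    if "ms \<in> F_tuples_last (Suc (length k')) n" for ms
    using that by (elim F_tuples_last_decomp) (auto simp: F_weight_snoc_Suc)
  then show ?thesis
    by (simp add: F_coeff_def sum_distrib_left)
qed

lemma F_coeff_snoc_one:
  assumes "0 < n" "0 < k" "0 < q"
  shows "F_coeff q (k' @ [k, Suc 0]) n =
    q ^ n / q_bracket q n * (\<Sum>a = 1..n. F_coeff q (k' @ [k]) a / q ^ a)"
proof -
  let ?T = "F_tuples_last (Suc (length k'))"
  have weight: "F_weight q (k' @ [k, Suc 0]) (ms @ [n]) =
      q ^ n / q_bracket q n * (F_weight q (k' @ [k]) ms / q ^ a)" if "ms \<in> ?T a" for ms a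
    using that assms by (elim F_tuples_last_decomp) (auto simp: F_weight_snoc_one)
  have "F_coeff q (k' @ [k, Suc 0]) n =
      (\<Sum>ms\<in>(\<Union>a\<in>{1..n}. ?T a). F_weight q (k' @ [k, Suc 0]) (ms @ [n]))"
    using assms(1) by (simp add: F_coeff_def F_tuples_last_Suc sum.reindex inj_on_def)
  also have "\<dots> = (\<Sum>a = 1..n. \<Sum>ms\<in>?T a. F_weight q (k' @ [k, Suc 0]) (ms @ [n]))"
    by (rule sum.UNION_disjoint) (auto simp: finite_F_tuples_last, auto simp: F_tuples_last_def)
  also have "\<dots> = (\<Sum>a = 1..n. \<Sum>ms\<in>?T a. q ^ n / q_bracket q n * (F_weight q (k' @ [k]) ms / q ^ a))"
    by (intro sum.cong refl weight)
  finally show ?thesis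
    by (simp add: F_coeff_def sum_distrib_left sum_divide_distrib)
qed

section \<open>Splitting off the smallest variable of \<open>G\<close>\<close>

text \<open>The lower bound \<open>m\<close> records the variable split off last; it becomes the
  second argument of the connector.\<close>

definition G_tails :: "nat list \<Rightarrow> nat \<Rightarrow> nat list list set" where
  "G_tails k m = {M \<in> G_tuples k. m < hd (hd M)}"

lemma G_tuples_Cons:
  "ms # M \<in> G_tuples (k # ks) \<longleftrightarrow> length ms = k \<and> sorted ms \<and> (\<forall>m\<in>set ms. 0 < m) \<and>
     M \<in> G_tuples ks \<and> (M \<noteq> [] \<longrightarrow> last ms < hd (hd M))"
proof -
  \<comment> \<open>Separating \<open>j = 0\<close> isolates the inequality between the first row
    and the rest.\<close>
  have split: "(\<forall>j. Q j) \<longleftrightarrow> Q 0 \<and> (\<forall>j. Q (Suc j))" for Q :: "nat \<Rightarrow> bool"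
    by (metis not0_implies_Suc)
  have "(\<forall>j. Suc j < length (ms # M) \<longrightarrow> last ((ms # M) ! j) < hd ((ms # M) ! Suc j)) \<longleftrightarrow>
     (\<forall>j. Suc j < length M \<longrightarrow> last (M ! j) < hd (M ! Suc j)) \<and> (M \<noteq> [] \<longrightarrow> last ms < hd (hd M))"
    by (subst split) (auto simp: hd_conv_nth)
  then show ?thesis
    unfolding G_tuples_def by auto
qed

lemma G_tuples_Nil [simp]: "G_tuples [] = {[]}"
  by (auto simp: G_tuples_def)

lemma G_tuples_ConsE:
  assumes "M \<in> G_tuples (k # ks)"
  obtains ms M' where "M = ms # M'" "length ms = k" "length M' = length ks"
  using assms by (cases M) (auto simp: G_tuples_def dest: map_eq_imp_length_eq)

lemma G_tuples_eq_G_tails: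
  assumes "is_index k"
  shows "G_tuples k = G_tails k 0"
proof -
  obtain c ks where k: "k = c # ks" "0 < c"
    using assms by (cases k) (auto simp: is_index_def)
  have "0 < hd (hd M)" if "M \<in> G_tuples k" for M
  proof -
    from that obtain ms M' where "M = ms # M'" "length ms = c"
      unfolding k by (rule G_tuples_ConsE)
    then show ?thesis
      using that k(2) by (cases ms) (auto simp: G_tuples_def)
  qed
  then show ?thesis
    by (auto simp: G_tails_def)
qed

lemma G_tails_one: "G_tails [Suc 0] m = (\<lambda>i. [[Suc i]]) ` {m..}"
proof (intro equalityI subsetI)
  fix M assume M: "M \<in> G_tails [Suc 0] m"
  then obtain n where "M = [[n]]" "m < n"
    by (auto simp: G_tails_def length_Suc_conv elim!: G_tuples_ConsE)
  then have "M = [[Suc (n - 1)]]" "n - 1 \<in> {m..}"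
    by auto
  then show "M \<in> (\<lambda>i. [[Suc i]]) ` {m..}"
    by blast
qed (auto simp: G_tails_def G_tuples_Cons)

text \<open>A row of length one is followed by a strict inequality, so the rest has to start above
  \<open>Suc i\<close>. Writing the new variable as \<open>Suc i\<close> with \<open>i\<close> from
  \<open>m\<close> on matches the ranges of the telescoping sums.\<close>

lemma bij_betw_G_tails_comma:
  "bij_betw (\<lambda>(i, M). [Suc i] # M) (SIGMA i:{m..}. G_tails (k # ks) (Suc i)) (G_tails (Suc 0 # k # ks) m)"
proof (rule bij_betw_byWitness[where f' = "\<lambda>M. (hd (hd M) - 1, tl M)"])
  show "(\<lambda>(i, M). [Suc i] # M) ` (SIGMA i:{m..}. G_tails (k # ks) (Suc i)) \<subseteq> G_tails (Suc 0 # k # ks) m"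
    by (auto simp: G_tails_def G_tuples_Cons)
  have decomp: "\<exists>n M'. M = [Suc n] # M' \<and> m \<le> n \<and> M' \<in> G_tails (k # ks) (Suc n)"
    if "M \<in> G_tails (Suc 0 # k # ks) m" for M
  proof -
    have "M \<in> G_tuples (Suc 0 # k # ks)"
      using that by (simp add: G_tails_def)
    then obtain ms M' where M: "M = ms # M'" "length ms = Suc 0" "length M' = length (k # ks)"
      by (rule G_tuples_ConsE)
    then obtain n where "ms = [n]"
      by (auto simp: length_Suc_conv)
    then show ?thesis
      using that M by (cases n) (auto simp: G_tails_def G_tuples_Cons)
  qed
  show "\<forall>M\<in>G_tails (Suc 0 # k # ks) m. (\<lambda>(i, M). [Suc i] # M) (hd (hd M) - 1, tl M) = M"
    using decomp by force
  show "(\<lambda>M. (hd (hd M) - 1, tl M)) ` G_tails (Suc 0 # k # ks) m \<subseteq> (SIGMA i:{m..}. G_tails (k # ks) (Suc i))"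
    using decomp by force
qed auto

text \<open>Inside a row the inequality is weak: the next entry is at least \<open>Suc i\<close>,
  that is, above \<open>i\<close>. Hence the remaining tail has the bound \<open>i\<close> where the
  comma case has \<open>Suc i\<close>.\<close>

lemma bij_betw_G_tails_plus:
  "bij_betw (\<lambda>(i, M). (Suc i # hd M) # tl M) (SIGMA i:{m..}. G_tails (Suc k # ks) i)
    (G_tails (Suc (Suc k) # ks) m)"
proof (rule bij_betw_byWitness[where f' = "\<lambda>M. (hd (hd M) - 1, tl (hd M) # tl M)"])
  have sorted: "sorted (a # ms) \<longleftrightarrow> a \<le> hd ms \<and> sorted ms" if "length ms = Suc k" for a :: nat and ms
    using that by (cases ms) auto
  have decomp: "\<exists>ms M'. M = ms # M' \<and> length ms = Suc k" if "M \<in> G_tails (Suc k # ks) i" for M i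
    using that by (auto simp: G_tails_def elim!: G_tuples_ConsE)
  show "(\<lambda>(i, M). (Suc i # hd M) # tl M) ` (SIGMA i:{m..}. G_tails (Suc k # ks) i)
      \<subseteq> G_tails (Suc (Suc k) # ks) m"
  proof safe
    fix i M assume "M \<in> G_tails (Suc k # ks) i" "i \<ge> m"
    moreover obtain ms M' where "M = ms # M'" "length ms = Suc k"
      using decomp calculation(1) by blast
    ultimately show "(Suc i # hd M) # tl M \<in> G_tails (Suc (Suc k) # ks) m"
      using sorted[of ms "Suc i"] by (cases ms) (auto simp: G_tails_def G_tuples_Cons)
  qed
  show "\<forall>x\<in>SIGMA i:{m..}. G_tails (Suc k # ks) i.
      (\<lambda>M. (hd (hd M) - 1, tl (hd M) # tl M)) ((\<lambda>(i, M). (Suc i # hd M) # tl M) x) = x"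
    using decomp by fastforce
  have decomp': "\<exists>n ms M'. M = (Suc n # ms) # M' \<and> m \<le> n \<and> ms # M' \<in> G_tails (Suc k # ks) n"
    if "M \<in> G_tails (Suc (Suc k) # ks) m" for M
  proof -
    have "M \<in> G_tuples (Suc (Suc k) # ks)"
      using that by (simp add: G_tails_def)
    then obtain ms M' where M: "M = ms # M'" "length ms = Suc (Suc k)"
      by (rule G_tuples_ConsE)
    then obtain n ms' where ms: "ms = n # ms'" "length ms' = Suc k"
      by (auto simp: length_Suc_conv)
    then show ?thesis
      using that M sorted[of ms' n] 
      by (cases n; cases ms') (auto simp: G_tails_def G_tuples_Cons split: if_splits)
  qed
  show "\<forall>M\<in>G_tails (Suc (Suc k) # ks) m.
      (\<lambda>(i, M). (Suc i # hd M) # tl M) (hd (hd M) - 1, tl (hd M) # tl M) = M"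
    using decomp' by force
  show "(\<lambda>M. (hd (hd M) - 1, tl (hd M) # tl M)) ` G_tails (Suc (Suc k) # ks) m
      \<subseteq> (SIGMA i:{m..}. G_tails (Suc k # ks) i)"
    using decomp' by force
qed

lemma G_term_one:
  "G_term q [Suc 0] z [[m]] =
    of_real (q ^ m) / of_real (q_bracket q m) - of_real (q ^ m) * z / q_bracket_log q z m"
  by (simp add: G_term_def)

lemma G_term_comma:
  "G_term q (Suc 0 # k # ks) z ([m] # M) = 1 / of_real (q_bracket q m) * G_term q (k # ks) z M"
  by (simp add: G_term_def Let_def prod.lessThan_Suc_shift del: prod.lessThan_Suc)

lemma G_term_plus:
  "G_term q (Suc (Suc k) # ks) z ((m # ms) # M) =
    1 / q_bracket_log q z m * G_term q (Suc k # ks) z (ms # M)"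
  \<comment> \<open>If \<open>ks\<close> is empty, the lengthened row is the last one, whose final
    factor has a different form.\<close>
  by (cases ks) (simp_all add: G_term_def Let_def prod.lessThan_Suc_shift del: prod.lessThan_Suc)

lemma G_term_plus_tails:
  assumes "M \<in> G_tails (Suc k # ks) i"
  shows "G_term q (Suc (Suc k) # ks) z ((m # hd M) # tl M) =
    1 / q_bracket_log q z m * G_term q (Suc k # ks) z M"
proof -
  have "M \<noteq> []"
    using assms by (auto simp: G_tails_def G_tuples_def)
  then show ?thesis
    using G_term_plus[of q k ks z m "hd M" "tl M"] by simp
qed

subsection \<open>The connector\<close>

lemma has_sum_diff:
  fixes f g :: "'a \<Rightarrow> 'b :: real_normed_vector"
  assumes "(f has_sum a) A" "(g has_sum b) A"
  shows "((\<lambda>x. f x - g x) has_sum (a - b)) A"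
  using has_sum_add[OF assms(1), of "\<lambda>x. - g x" "- b"] assms(2) by (simp add: has_sum_uminus)

lemma summable_on_diff:
  fixes f g :: "'a \<Rightarrow> 'b :: real_normed_vector"
  assumes "f summable_on A" "g summable_on A"
  shows "(\<lambda>x. f x - g x) summable_on A"
  using assms unfolding summable_on_def by (blast intro: has_sum_diff)

text \<open>Summability lets the unordered sum be computed as an ordinary series, whose partial sums
  telescope to \<open>D a\<close> minus a null sequence.\<close>

lemma infsum_telescope:
  fixes D :: "nat \<Rightarrow> 'a :: banach"
  assumes "(\<lambda>n. D n - D (Suc n)) summable_on {a..}" and "D \<longlonglongrightarrow> 0"
  shows "(\<Sum>\<^sub>\<infinity>n\<in>{a..}. D n - D (Suc n)) = D a"
proof -
  let ?f = "\<lambda>n. D n - D (Suc n)"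
  have bij: "bij_betw (\<lambda>i. i + a) UNIV {a..}"
    by (rule bij_betw_byWitness[where f' = "\<lambda>n. n - a"]) auto
  have "(\<lambda>i. ?f (i + a)) summable_on UNIV"
    using assms(1) summable_on_reindex_bij_betw[OF bij, of ?f] by simp
  then have "(\<lambda>i. ?f (i + a)) sums (\<Sum>\<^sub>\<infinity>i. ?f (i + a))"
    by (intro has_sum_imp_sums has_sum_infsum)
  moreover have "(\<lambda>i. D (i + a)) \<longlonglongrightarrow> 0"
    using assms(2) by (rule LIMSEQ_ignore_initial_segment)
  then have "(\<lambda>i. ?f (i + a)) sums D a"
    using telescope_sums'[of "\<lambda>i. D (i + a)" 0] by simp
  ultimately have "(\<Sum>\<^sub>\<infinity>i. ?f (i + a)) = D a"
    by (rule sums_unique2)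
  then show ?thesis
    using infsum_reindex_bij_betw[OF bij, of ?f] by simp
qed

lemma q_bracket_ge_1:
  assumes "0 < q" "q < 1" "0 < m"
  shows "1 \<le> q_bracket q m"
proof -
  have "q ^ m \<le> q ^ 1"
    using assms by (intro power_decreasing) auto
  then show ?thesis
    using assms by (simp add: q_bracket_def)
qed

locale kawashima =
  fixes q :: real and z :: complex
  assumes q: "0 < q" "q < 1" and z: "norm z < 1 / q"
begin

definition P :: "nat \<Rightarrow> complex" where
  "P n = (\<Prod>j = 1..n. (z - of_real q ^ (j - 1)) / (1 - of_real q ^ j))"

text \<open>\<open>conn_coeff n m\<close> is \<open>q\<^sup>n\<^sup>m (q;q)\<^sub>n (q;q)\<^sub>m / (q;q)\<^sub>n\<^sub>+\<^sub>m\<close>.\<close>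

definition conn_coeff :: "nat \<Rightarrow> nat \<Rightarrow> real" where
  "conn_coeff n m = (\<Prod>j<m. q ^ n * (1 - q ^ Suc j) / (1 - q ^ Suc (n + j)))"

definition conn :: "nat \<Rightarrow> nat \<Rightarrow> complex" where
  "conn n m = of_real (conn_coeff n m) * P n"

lemma q_power_less_1: "0 < n \<Longrightarrow> q ^ n < 1"
  using q by (simp add: power_less_one_iff)

lemma q_power_neq_1 [simp]: "0 < n \<Longrightarrow> q ^ n \<noteq> 1" "q * q ^ n \<noteq> 1"
  using q_power_less_1[of n] q_power_less_1[of "Suc n"] by auto

lemma of_real_q_power_neq_1 [simp]:
  "0 < n \<Longrightarrow> of_real q ^ n \<noteq> (1 :: complex)" "of_real q * of_real q ^ n \<noteq> (1 :: complex)"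
  using q_power_neq_1[of n] by (metis of_real_1 of_real_eq_iff of_real_power of_real_mult)+

lemma P_Suc: "P (Suc n) = P n * (z - of_real q ^ n) / (1 - of_real q ^ Suc n)"
  by (simp add: P_def)

lemma conn_0 [simp]: "conn n 0 = P n"
  by (simp add: conn_def conn_coeff_def)

lemma conn_coeff_Suc_right:
  "conn_coeff n (Suc m) = conn_coeff n m * (q ^ n * (1 - q ^ Suc m) / (1 - q ^ Suc (n + m)))"
  by (simp add: conn_coeff_def)

lemma conn_Suc_right:
  "conn n (Suc m) =
    conn n m * (of_real q ^ n * (1 - of_real q ^ Suc m) / (1 - of_real q ^ Suc (n + m)))"
  by (simp add: conn_def conn_coeff_Suc_right)

text \<open>The quotient \<open>q^(nm) (q;q)_n (q;q)_m / (q;q)_(n+m)\<close> is symmetric in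
  \<open>n\<close> and \<open>m\<close>, so this mirrors \<open>conn_coeff_Suc_right\<close>. The
  product in the definition runs over the second argument, hence the induction on
  \<open>m\<close>.\<close>

lemma conn_coeff_Suc_left:
  "conn_coeff (Suc n) m = conn_coeff n m * (q ^ m * (1 - q ^ Suc n) / (1 - q ^ Suc (n + m)))"
proof (induction m)
  case 0
  then show ?case by (simp add: conn_coeff_def)
next
  case (Suc m)
  then show ?case
    unfolding conn_coeff_Suc_right[of _ m] by simp
qed

text \<open>The factor \<open>1 - q ^ Suc n\<close> of the coefficient cancels against the new
  denominator in \<open>P (Suc n)\<close>.\<close>

lemma conn_Suc_left:
  "conn (Suc n) m = conn n m * (of_real q ^ m * (z - of_real q ^ n) / (1 - of_real q ^ Suc (n + m)))"
  by (simp add: conn_def conn_coeff_Suc_left P_Suc)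

text \<open>Each of the \<open>m\<close> factors is at most \<open>q ^ n\<close>, because
  \<open>1 - q ^ Suc j\<close> is at most \<open>1 - q ^ Suc (n + j)\<close>.\<close>

lemma conn_coeff_bounds: "0 \<le> conn_coeff n m" "conn_coeff n m \<le> q ^ (n * m)"
proof -
  have pos: "0 < 1 - q ^ Suc i" for i
    using q_power_less_1[of "Suc i"] by simp
  have "0 \<le> q ^ n * (1 - q ^ Suc j) / (1 - q ^ Suc (n + j))" for j
    using pos[of j] pos[of "n + j"] q by (intro divide_nonneg_pos mult_nonneg_nonneg) auto
  then show "0 \<le> conn_coeff n m"
    unfolding conn_coeff_def by (intro prod_nonneg) auto
  have le: "q ^ n * (1 - q ^ Suc j) / (1 - q ^ Suc (n + j)) \<le> q ^ n" for j
  proof -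
    have "q ^ Suc (n + j) \<le> q ^ Suc j"
      using q by (intro power_decreasing) auto
    then have "q ^ n * (1 - q ^ Suc j) \<le> q ^ n * (1 - q ^ Suc (n + j))"
      using q by (intro mult_left_mono) auto
    then show ?thesis
      using pos[of "n + j"] by (simp add: pos_divide_le_eq)
  qed
  have "conn_coeff n m \<le> (\<Prod>j<m. q ^ n)"
    unfolding conn_coeff_def
    using \<open>\<And>j. 0 \<le> q ^ n * (1 - q ^ Suc j) / (1 - q ^ Suc (n + j))\<close> le
    by (intro prod_mono) blast
  then show "conn_coeff n m \<le> q ^ (n * m)"
    by (simp add: power_mult)
qed

lemma norm_conn_le: "norm (conn n m) \<le> q ^ (n * m) * norm (P n)"
  using conn_coeff_bounds by (simp add: conn_def norm_mult mult_right_mono)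

lemma norm_conn_le_right: "0 < n \<Longrightarrow> norm (conn n m) \<le> q ^ m * norm (P n)"
proof -
  assume "0 < n"
  then have "q ^ (n * m) \<le> q ^ m"
    using q by (intro power_decreasing) auto
  then show ?thesis
    using norm_conn_le[of n m] by (meson mult_right_mono norm_ge_zero order_trans)
qed

text \<open>Ratio test: the ratio of successive terms is bounded by a sequence tending to
  \<open>q * norm z\<close>, which is below 1. The power of \<open>n\<close> is there to absorb the
  polynomial growth of \<open>dual_coeff k n / q ^ n\<close>.\<close>

lemma summable_P: "(\<lambda>n. real n ^ w * q ^ n * norm (P n)) summable_on A"
proof -
  let ?f = "\<lambda>n. real n ^ w * q ^ n * norm (P n)"
  let ?r = "\<lambda>n. (1 + 1 / real n) ^ w * (q * norm (z - of_real q ^ n) / norm (1 - of_real q ^ Suc n :: complex))"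
  obtain c where c: "q * norm z < c" "c < 1"
    using q z dense[of "q * norm z" 1] by (auto simp: field_simps)
  have "(\<lambda>n. of_real q ^ n :: complex) \<longlonglongrightarrow> 0"
    using q by (intro LIMSEQ_power_zero) auto
  moreover have "(\<lambda>n. 1 / real n) \<longlonglongrightarrow> 0"
    by (rule lim_1_over_n)
  moreover have "(\<lambda>n. of_real q ^ Suc n :: complex) \<longlonglongrightarrow> 0"
    using calculation(1) by (rule LIMSEQ_Suc)
  ultimately have "?r \<longlonglongrightarrow> (1 + 0) ^ w * (q * norm (z - 0) / norm (1 - 0 :: complex))"
    by (intro tendsto_mult tendsto_divide tendsto_power tendsto_add tendsto_norm tendsto_diff
        tendsto_const) auto
  then have "\<forall>\<^sub>F n in sequentially. ?r n < c"
    using c by (intro order_tendstoD(2)[of ?r]) auto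
  then obtain N where N: "\<And>n. n \<ge> N \<Longrightarrow> ?r n < c"
    by (auto simp: eventually_sequentially)
  have "summable ?f"
  proof (rule summable_ratio_test[OF \<open>c < 1\<close>, of "Suc N"])
    \<comment> \<open>Starting at \<open>Suc N\<close> keeps \<open>n\<close> positive, since
      \<open>?r n\<close> divides by \<open>real n\<close>.\<close>
    fix n assume n: "n \<ge> Suc N"
    then have "real (Suc n) ^ w = (1 + 1 / real n) ^ w * real n ^ w"
      by (simp add: power_mult_distrib[symmetric] field_simps)
    then have "?f (Suc n) = ?r n * ?f n"
      by (simp add: P_Suc norm_mult norm_divide)
    also have "\<dots> \<le> c * ?f n"
      using N[of n] n q by (intro mult_right_mono) auto
    finally show "norm (?f (Suc n)) \<le> c * norm (?f n)"
      using q by simp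
  qed
  then have "?f summable_on UNIV"
    using q by (intro norm_summable_imp_summable_on) simp
  then show ?thesis
    by (rule summable_on_subset_banach) simp
qed

lemma P_tendsto: "(\<lambda>n. q ^ n * norm (P n)) \<longlonglongrightarrow> 0"
  using summable_P[of 0 UNIV] summable_on_imp_summable summable_LIMSEQ_zero by fastforce

text \<open>For positive \<open>m\<close> the norm of \<open>z * q ^ m\<close> is at most
  \<open>q * norm z < 1\<close>, so the brackets \<open>[m + log_q z]\<close> stay away from zero
  uniformly in \<open>m\<close>.\<close>

lemma one_minus_bounds:
  assumes "0 < m"
  shows "1 - q * norm z \<le> norm (1 - z * of_real q ^ m)" "0 < 1 - q * norm z"
proof -
  have "q ^ m \<le> q ^ 1"
    using assms q by (intro power_decreasing) auto
  then have "norm (z * of_real q ^ m) \<le> q * norm z"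
    using q mult_left_mono[of "q ^ m" q "norm z"] by (simp add: norm_mult norm_power mult.commute)
  then show "1 - q * norm z \<le> norm (1 - z * of_real q ^ m)"
    using norm_triangle_ineq2[of 1 "z * of_real q ^ m"] by simp
  show "0 < 1 - q * norm z"
    using q z by (simp add: field_simps)
qed

lemma z_q_power_neq_1 [simp]: "0 < m \<Longrightarrow> z * of_real q ^ m \<noteq> 1" "z * (of_real q * of_real q ^ n) \<noteq> 1"
  using one_minus_bounds[of m] one_minus_bounds[of "Suc n"] by auto

lemma norm_inverse_q_bracket_log:
  "0 < m \<Longrightarrow> norm (1 / q_bracket_log q z m) \<le> 1 / (1 - q * norm z)"
proof -
  assume m: "0 < m"
  have "norm (1 / q_bracket_log q z m) = (1 - q) / norm (1 - z * of_real q ^ m)"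
  proof -
    have "norm (1 - of_real q :: complex) = 1 - q"
      using q by (metis abs_of_pos diff_gt_0_iff_gt norm_of_real of_real_1 of_real_diff)
    then show ?thesis by (simp add: q_bracket_log_def norm_divide)
  qed
  also have "\<dots> \<le> 1 / (1 - q * norm z)"
    using q one_minus_bounds[OF m] by (intro frac_le) auto
  finally show ?thesis .
qed

lemma norm_inverse_q_bracket:
  "0 < m \<Longrightarrow> norm (1 / of_real (q_bracket q m) :: complex) \<le> 1"
  using q_bracket_ge_1[OF q, of m] by (simp add: norm_divide)

section \<open>Telescoping identities for the connector\<close>

text \<open>By \<open>conn_Suc_right\<close> the difference is \<open>conn n m\<close> times
  \<open>(1 - q ^ n) / (1 - q ^ Suc (n + m))\<close>, and \<open>1 - q ^ n\<close> cancels against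
  \<open>[n]\<close>.\<close>

lemma conn_diff:
  assumes "0 < n"
  shows "of_real (q ^ n / q_bracket q n) * (conn n m - conn n (Suc m)) =
    1 / of_real (q_bracket q (Suc m)) * conn n (Suc m)"
proof -
  have "1 - of_real q \<noteq> (0::complex)" "1 - of_real q ^ n \<noteq> (0::complex)"
    "1 - of_real q * of_real q ^ m \<noteq> (0::complex)" "1 - of_real q * of_real q ^ (n + m) \<noteq> (0::complex)"
    using of_real_q_power_neq_1(1)[of n] of_real_q_power_neq_1(1)[of 1] assms by auto
  then show ?thesis
    by (simp add: conn_Suc_right q_bracket_def divide_simps) (simp add: algebra_simps power_add)
qed

lemma summable_on_geometric: "(\<lambda>i. C * q ^ i) summable_on A"
proof -
  have "(\<lambda>i. C * q ^ i) summable_on UNIV"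
    using q by (intro norm_summable_imp_summable_on) (simp add: abs_mult summable_mult)
  then show ?thesis
    by (rule summable_on_subset_banach) simp
qed

lemma abs_summable_geometric:
  fixes f :: "nat \<Rightarrow> complex"
  assumes "\<And>i. i \<in> A \<Longrightarrow> norm (f i) \<le> C * q ^ i"
  shows "(\<lambda>i. norm (f i)) summable_on A"
  using summable_on_geometric assms by (rule Infinite_Sum.abs_summable_on_comparison_test')

lemma geometric_tendsto_0:
  fixes f :: "nat \<Rightarrow> complex"
  assumes "\<And>i. norm (f i) \<le> C * q ^ i"
  shows "f \<longlonglongrightarrow> 0"
proof (rule Lim_null_comparison)
  show "(\<lambda>i. C * q ^ i) \<longlonglongrightarrow> 0"
    using q by (intro tendsto_mult_right_zero LIMSEQ_power_zero) auto
qed (use assms in auto)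

text \<open>Summing \<open>conn_diff\<close> over the second argument telescopes; the boundary term
  vanishes because, for positive \<open>n\<close>, \<open>conn n i\<close> is bounded by a multiple
  of \<open>q ^ i\<close>.\<close>

lemma conn_strict:
  assumes "0 < n"
  shows "of_real (q ^ n / q_bracket q n) * conn n m =
    (\<Sum>\<^sub>\<infinity>i\<in>{m..}. 1 / of_real (q_bracket q (Suc i)) * conn n (Suc i))"
proof -
  let ?c = "of_real (q ^ n / q_bracket q n) :: complex"
  let ?D = "\<lambda>i. ?c * conn n i"
  have bound: "norm (?D i) \<le> norm ?c * norm (P n) * q ^ i" for i
    unfolding norm_mult mult.assoc
    using norm_conn_le_right[OF assms, of i] by (intro mult_left_mono) (auto simp: mult.commute)
  have eq: "?D i - ?D (Suc i) = 1 / of_real (q_bracket q (Suc i)) * conn n (Suc i)" for i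
    using conn_diff[OF assms, of i] by (simp add: right_diff_distrib)
  have "?D summable_on {m..}" for m
    using bound by (intro abs_summable_summable[OF abs_summable_geometric])
  then have "?D summable_on UNIV"
    by (metis atLeast_0)
  then have "?D summable_on A" for A
    by (rule summable_on_subset_banach) simp
  moreover have "(\<lambda>i. ?D (Suc i)) summable_on {m..}"
    by (rule abs_summable_summable, rule abs_summable_geometric[of _ _ "norm ?c * norm (P n) * q"])
      (use bound in \<open>simp add: mult.assoc flip: power_Suc\<close>)
  ultimately have "(\<lambda>i. ?D i - ?D (Suc i)) summable_on {m..}"
    by (intro summable_on_diff) auto
  then have "(\<Sum>\<^sub>\<infinity>i\<in>{m..}. ?D i - ?D (Suc i)) = ?D m"
    using bound by (intro infsum_telescope geometric_tendsto_0) auto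
  then show ?thesis
    by (simp only: eq)
qed

text \<open>The factor \<open>q ^ n\<close> is what makes \<open>P n\<close> summable on the whole
  disc for \<open>z\<close>; the connector supplies it as soon as \<open>m\<close> is
  positive.\<close>

lemma norm_conn_le_left:
  assumes "0 < m"
  shows "norm (conn n m) \<le> q ^ n * norm (P n)"
proof -
  have "q ^ (n * m) \<le> q ^ n"
    using q assms by (intro power_decreasing) auto
  then show ?thesis
    using norm_conn_le[of n m] by (meson mult_right_mono norm_ge_zero order_trans)
qed

lemma infsum_conn:
  assumes "0 < m"
  shows "(\<Sum>\<^sub>\<infinity>n\<in>{a..}. conn n m) = (1 - of_real q ^ (a + m)) / (1 - z * of_real q ^ m) * conn a m"
proof -
  \<comment> \<open>In \<open>?D (Suc n)\<close> the numerator cancels the denominator from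
    \<open>conn_Suc_left\<close>, so the difference has the numerator
    \<open>(1 - q^(n+m)) - q^m (z - q^n) = 1 - z q^m\<close> in front of
    \<open>conn n m\<close>.\<close>
  let ?D = "\<lambda>n. (1 - of_real q ^ (n + m)) / (1 - z * of_real q ^ m) * conn n m"
  have diff: "?D n - ?D (Suc n) = conn n m" for n
  proof -
    have "1 - z * of_real q ^ m \<noteq> 0" "1 - of_real q * of_real q ^ (n + m) \<noteq> (0::complex)"
      using assms by auto
    then show ?thesis
      by (simp add: conn_Suc_left divide_simps) (simp add: algebra_simps power_add)
  qed
  have lim: "(\<lambda>n. conn n m) \<longlonglongrightarrow> 0"
    using P_tendsto by (rule Lim_null_comparison[rotated]) (use norm_conn_le_left[OF assms] in auto)
  have "(\<lambda>n. of_real q ^ n :: complex) \<longlonglongrightarrow> 0"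
    using q by (intro LIMSEQ_power_zero) auto
  then have "(\<lambda>n. of_real q ^ (n + m) :: complex) \<longlonglongrightarrow> 0"
    by (rule LIMSEQ_ignore_initial_segment)
  then have "?D \<longlonglongrightarrow> (1 - 0) / (1 - z * of_real q ^ m) * 0"
    using lim assms by (intro tendsto_intros) auto
  then have "?D \<longlonglongrightarrow> 0"
    by simp
  moreover have "(\<lambda>n. norm (conn n m)) summable_on {a..}"
    using summable_P[of 0 "{a..}"] norm_conn_le_left[OF assms]
    by (intro Infinite_Sum.abs_summable_on_comparison_test') auto
  then have "(\<lambda>n. conn n m) summable_on {a..}"
    by (rule abs_summable_summable)
  ultimately show ?thesis
    using infsum_telescope[of ?D a] by (simp only: diff)
qed

text \<open>The factor \<open>q ^ m\<close> in the second bound makes the sum tend to 0 as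
  \<open>m\<close> grows, which the telescoping in \<open>conn_weak\<close> requires.\<close>

lemma abs_summable_weighted_conn:
  assumes "A \<subseteq> {0<..}"
  shows "(\<lambda>n. norm (of_real (q ^ n / q_bracket q n) * conn n m)) summable_on A"
    and "infsum (\<lambda>n. norm (of_real (q ^ n / q_bracket q n) * conn n m)) A
      \<le> infsum (\<lambda>n. q ^ n * norm (P n)) UNIV * q ^ m"
proof -
  let ?f = "\<lambda>n. of_real (q ^ n / q_bracket q n) * conn n m"
  have bound: "norm (?f n) \<le> q ^ n * norm (P n) * q ^ m" if "n \<in> A" for n
  proof -
    have n: "0 < n" using that assms by auto
    have "q ^ n / q_bracket q n \<le> q ^ n / 1"
      using q_bracket_ge_1[OF q n] q by (intro divide_left_mono) auto
    moreover have "0 \<le> q ^ n / q_bracket q n"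
      using q_bracket_ge_1[OF q n] q by simp
    ultimately have "norm (?f n) \<le> q ^ n * (q ^ m * norm (P n))"
      unfolding norm_mult norm_of_real using norm_conn_le_right[OF n, of m] by (intro mult_mono) auto
    then show ?thesis
      by (simp add: mult_ac)
  qed
  have s: "(\<lambda>n. q ^ n * norm (P n) * q ^ m) summable_on B" for B
    using summable_P[of 0 B] by (intro summable_on_cmult_left) simp
  show sf: "(\<lambda>n. norm (?f n)) summable_on A"
    using s bound by (rule Infinite_Sum.abs_summable_on_comparison_test')
  have "infsum (\<lambda>n. norm (?f n)) A \<le> infsum (\<lambda>n. q ^ n * norm (P n) * q ^ m) UNIV"
    using sf s bound q by (intro infsum_mono_neutral) auto
  then show "infsum (\<lambda>n. norm (?f n)) A \<le> infsum (\<lambda>n. q ^ n * norm (P n)) UNIV * q ^ m"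
    by (simp only: infsum_cmult_left')
qed

text \<open>The whole left side is telescoped in its second argument: \<open>conn_diff\<close> turns
  each difference into a sum of \<open>conn n (Suc i)\<close> over \<open>n\<close>, which
  \<open>infsum_conn\<close> evaluates.\<close>

lemma conn_weak:
  assumes "0 < a"
  shows "(\<Sum>\<^sub>\<infinity>n\<in>{a..}. of_real (q ^ n / q_bracket q n) * conn n m) =
    (\<Sum>\<^sub>\<infinity>i\<in>{m..}. of_real (q ^ a) / q_bracket_log q z (Suc i) * conn a i)"
proof -
  let ?D = "\<lambda>i. \<Sum>\<^sub>\<infinity>n\<in>{a..}. of_real (q ^ n / q_bracket q n) * conn n i"
  note summable = abs_summable_weighted_conn[of "{a..}"]
  have a: "{a..} \<subseteq> {0<..}"
    using assms by auto
  have eq: "?D i - ?D (Suc i) = of_real (q ^ a) / q_bracket_log q z (Suc i) * conn a i" for i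
  proof -
    have "?D i - ?D (Suc i) = (\<Sum>\<^sub>\<infinity>n\<in>{a..}.
        of_real (q ^ n / q_bracket q n) * conn n i - of_real (q ^ n / q_bracket q n) * conn n (Suc i))"
      by (intro infsumI[symmetric] has_sum_diff has_sum_infsum abs_summable_summable[OF summable(1)] a)
    also have "\<dots> = (\<Sum>\<^sub>\<infinity>n\<in>{a..}. 1 / of_real (q_bracket q (Suc i)) * conn n (Suc i))"
      using assms by (intro infsum_cong, subst right_diff_distrib[symmetric], subst conn_diff) auto
    also have "\<dots> = 1 / of_real (q_bracket q (Suc i)) *
        ((1 - of_real q ^ (a + Suc i)) / (1 - z * of_real q ^ Suc i) * conn a (Suc i))"
      by (simp only: infsum_cmult_right' infsum_conn[OF zero_less_Suc])
    \<comment> \<open>\<open>conn_Suc_right\<close> leads back to \<open>conn a i\<close>: its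
      denominator cancels \<open>1 - q^(a+i+1)\<close>, its factor \<open>1 - q^(i+1)\<close>
      cancels against \<open>[i+1]\<close>, and \<open>q^a\<close> remains.\<close>
    also have "\<dots> = of_real (q ^ a) / q_bracket_log q z (Suc i) * conn a i"
    proof -
      have "1 - of_real q \<noteq> (0::complex)" "1 - z * (of_real q * of_real q ^ i) \<noteq> 0"
        "1 - of_real q * of_real q ^ i \<noteq> (0::complex)" "1 - of_real q * of_real q ^ (a + i) \<noteq> (0::complex)"
        using of_real_q_power_neq_1(1)[of 1] by auto
      then show ?thesis
        by (simp add: conn_Suc_right q_bracket_def q_bracket_log_def divide_simps)
    qed
    finally show ?thesis .
  qed
  have "norm (?D i) \<le> infsum (\<lambda>n. q ^ n * norm (P n)) UNIV * q ^ i" for i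
    using norm_infsum_bound[OF summable(1)[OF a, of i]] summable(2)[OF a, of i] by linarith
  then have "?D \<longlonglongrightarrow> 0"
    by (rule geometric_tendsto_0)
  moreover have "(\<lambda>i. ?D i - ?D (Suc i)) summable_on {m..}"
  proof -
    have "norm (of_real (q ^ a) / q_bracket_log q z (Suc i) * conn a i) \<le>
        1 / (1 - q * norm z) * norm (P a) * q ^ i" for i
    proof -
      have "norm (of_real (q ^ a) / q_bracket_log q z (Suc i)) \<le> 1 / (1 - q * norm z)"
      proof -
        have "norm (of_real (q ^ a) :: complex) \<le> 1"
          using q by (simp add: norm_power power_le_one)
        then show ?thesis
          using mult_mono[of "norm (of_real (q ^ a) :: complex)" 1, OF _ norm_inverse_q_bracket_log[of "Suc i"]]
          by (simp add: norm_divide)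
      qed
      then have "norm (of_real (q ^ a) / q_bracket_log q z (Suc i)) * norm (conn a i)
          \<le> 1 / (1 - q * norm z) * (q ^ i * norm (P a))"
        using norm_conn_le_right[OF assms, of i] one_minus_bounds(2)[of 1] by (intro mult_mono) auto
      then show ?thesis
        unfolding norm_mult by (simp add: mult_ac)
    qed
    then show ?thesis
      unfolding eq by (intro abs_summable_summable[OF abs_summable_geometric])
  qed
  ultimately have "(\<Sum>\<^sub>\<infinity>i\<in>{m..}. ?D i - ?D (Suc i)) = ?D m"
    by (intro infsum_telescope)
  then show ?thesis
    by (simp only: eq)
qed

subsection \<open>Absolute convergence of \<open>G\<close>\<close>

lemma infsum_geometric_atLeast: "(\<Sum>\<^sub>\<infinity>i\<in>{m..}. q ^ i) = q ^ m / (1 - q)"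
proof -
  have eq: "q ^ i / (1 - q) - q ^ Suc i / (1 - q) = q ^ i" for i
  proof -
    have "q ^ i - q ^ Suc i = q ^ i * (1 - q)"
      by (simp add: algebra_simps)
    then show ?thesis
      using q by (simp flip: diff_divide_distrib)
  qed
  have "(\<lambda>i. q ^ i) summable_on {m..}"
    using summable_on_geometric[of 1] by simp
  moreover have "(\<lambda>i. q ^ i / (1 - q)) \<longlonglongrightarrow> 0"
    using q by (intro tendsto_divide_zero LIMSEQ_power_zero) auto
  ultimately show ?thesis
    using infsum_telescope[of "\<lambda>i. q ^ i / (1 - q)" m] by (simp only: eq)
qed

text \<open>Abstract form of splitting off the smallest variable: bounded weights times fibres of
  size at most \<open>K * q ^ i\<close> sum to at most a constant times \<open>q ^ m\<close>. This
  shape of bound reproduces itself, so an induction over the index can use it.\<close>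

lemma infsum_fibred:
  fixes f :: "'b \<Rightarrow> complex" and g :: "'a \<Rightarrow> complex"
  assumes bij: "bij_betw h (SIGMA i:{m..}. T i) S"
    and f: "\<And>i M. m \<le> i \<Longrightarrow> M \<in> T i \<Longrightarrow> f (h (i, M)) = w i * g M"
    and w: "\<And>i. norm (w i) \<le> C"
    and g: "\<And>i. (\<lambda>M. norm (g M)) summable_on T i" "\<And>i. infsum (\<lambda>M. norm (g M)) (T i) \<le> K * q ^ i"
  shows "(\<lambda>M. norm (f M)) summable_on S"
    and "infsum (\<lambda>M. norm (f M)) S \<le> C * K / (1 - q) * q ^ m"
    and "infsum f S = (\<Sum>\<^sub>\<infinity>i\<in>{m..}. w i * infsum g (T i))"
proof -
  let ?\<Sigma> = "SIGMA i:{m..}. T i"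
  let ?F = "\<lambda>x. w (fst x) * g (snd x)"
  have fF: "f (h x) = ?F x" if "x \<in> ?\<Sigma>" for x
    using that f by auto
  have inner: "infsum (\<lambda>M. norm (?F (i, M))) (T i) = norm (w i) * infsum (\<lambda>M. norm (g M)) (T i)" for i
    by (simp add: norm_mult infsum_cmult_right')
  have inner_le: "norm (w i) * infsum (\<lambda>M. norm (g M)) (T i) \<le> C * K * q ^ i" for i
    using w[of i] g(2)[of i] mult_mono[OF w[of i] g(2)[of i]] norm_ge_zero[of "w i"]
    by (simp add: infsum_nonneg mult.assoc)
  note geom = summable_on_geometric[of "C * K" "{m..}"]
  have outer: "(\<lambda>i. norm (w i) * infsum (\<lambda>M. norm (g M)) (T i)) summable_on {m..}"
    using geom inner_le by (rule summable_on_comparison_test) (auto intro!: mult_nonneg_nonneg infsum_nonneg)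
  have summable: "(\<lambda>x. norm (?F x)) summable_on ?\<Sigma>"
  proof (rule summable_on_SigmaI[OF _ outer])
    show "((\<lambda>M. norm (?F (i, M))) has_sum norm (w i) * infsum (\<lambda>M. norm (g M)) (T i)) (T i)" for i
      using g(1)[of i] by (simp add: norm_mult has_sum_cmult_right has_sum_infsum)
  qed auto
  \<comment> \<open>An arbitrary \<open>F\<close> allows use both with the norm and with the
    identity.\<close>
  have reindex: "infsum (\<lambda>M. F (f M)) S = infsum (\<lambda>x. F (?F x)) ?\<Sigma>"
    "(\<lambda>M. F (f M)) summable_on S \<longleftrightarrow> (\<lambda>x. F (?F x)) summable_on ?\<Sigma>" for F :: "complex \<Rightarrow> 'c :: real_normed_vector"
    unfolding infsum_reindex_bij_betw[OF bij, symmetric] summable_on_reindex_bij_betw[OF bij, symmetric]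
    by (intro infsum_cong summable_on_cong; simp only: fF)+
  show "(\<lambda>M. norm (f M)) summable_on S"
    using summable unfolding reindex .
  have "infsum (\<lambda>M. norm (f M)) S = (\<Sum>\<^sub>\<infinity>i\<in>{m..}. infsum (\<lambda>M. norm (?F (i, M))) (T i))"
    unfolding reindex by (rule infsum_Sigma_banach[OF summable, symmetric])
  also have "\<dots> \<le> (\<Sum>\<^sub>\<infinity>i\<in>{m..}. C * K * q ^ i)"
    unfolding inner using outer geom inner_le by (rule infsum_mono)
  also have "\<dots> = C * K / (1 - q) * q ^ m"
    by (simp add: infsum_cmult_right' infsum_geometric_atLeast)
  finally show "infsum (\<lambda>M. norm (f M)) S \<le> C * K / (1 - q) * q ^ m" .
  have "infsum f S = (\<Sum>\<^sub>\<infinity>i\<in>{m..}. infsum (\<lambda>M. ?F (i, M)) (T i))"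
    using reindex(1)[of "\<lambda>x. x"] infsum_Sigma_banach[OF abs_summable_summable[OF summable]] by simp
  then show "infsum f S = (\<Sum>\<^sub>\<infinity>i\<in>{m..}. w i * infsum g (T i))"
    by (simp add: infsum_cmult_right')
qed

text \<open>Over a common denominator the two fractions of the final factor combine to the numerator
  \<open>1 - z\<close>, whereas \<open>conn 1 i\<close> contains \<open>z - 1\<close>. This sign is
  the minus in the definition of \<open>F\<close>.\<close>

lemma G_term_one_eq:
  "G_term q [Suc 0] z [[Suc i]] = - (of_real q / q_bracket_log q z (Suc i) * conn 1 i)"
proof -
  have nz: "1 - of_real q \<noteq> (0::complex)" "1 - z * (of_real q * of_real q ^ i) \<noteq> 0"
      "1 - of_real q * of_real q ^ i \<noteq> (0::complex)"
    using of_real_q_power_neq_1(1)[of 1] by auto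
  have conn: "conn 1 i = of_real q ^ i * (z - 1) / (1 - of_real q ^ Suc i)"
    using conn_Suc_left[of 0 i] by (simp add: conn_def[of 0] conn_coeff_def P_def)
  show ?thesis
    unfolding conn using nz
    by (simp add: G_term_one q_bracket_def q_bracket_log_def divide_simps) (simp add: algebra_simps)
qed

text \<open>The constant \<open>K\<close> is uniform in \<open>m\<close>, so the decay
  \<open>q ^ m\<close> pays for the sum over the next variable to be prefixed.\<close>

lemma G_term_summable:
  assumes "is_index k"
  shows "\<exists>K. \<forall>m. (\<lambda>M. norm (G_term q k z M)) summable_on G_tails k m \<and>
    infsum (\<lambda>M. norm (G_term q k z M)) (G_tails k m) \<le> K * q ^ m"
  using assms
proof (induction rule: index_induct)
  case one
  define C where "C = q / (1 - q * norm z) * norm (P 1)"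
  have bound: "norm (G_term q [Suc 0] z [[Suc i]]) \<le> C * q ^ i" for i
  proof -
    have "norm (G_term q [Suc 0] z [[Suc i]]) =
        q * (norm (1 / q_bracket_log q z (Suc i)) * norm (conn 1 i))"
      using q by (simp add: G_term_one_eq norm_mult norm_divide)
    also have "\<dots> \<le> q * (1 / (1 - q * norm z) * (q ^ i * norm (P 1)))"
      using q norm_inverse_q_bracket_log[of "Suc i"] norm_conn_le_right[of 1 i] one_minus_bounds(2)[of 1]
      by (intro mult_left_mono mult_mono) auto
    finally show ?thesis
      by (simp add: C_def mult_ac)
  qed
  have sum: "(\<lambda>i. norm (G_term q [Suc 0] z [[Suc i]])) summable_on {m..}" for m
    by (rule abs_summable_geometric[OF bound])
  have inj: "inj_on (\<lambda>i. [[Suc i]]) {m..}" for m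
    by (auto simp: inj_on_def)
  have "infsum (\<lambda>M. norm (G_term q [Suc 0] z M)) (G_tails [Suc 0] m) \<le> C / (1 - q) * q ^ m" for m
  proof -
    have "infsum (\<lambda>M. norm (G_term q [Suc 0] z M)) (G_tails [Suc 0] m)
        = (\<Sum>\<^sub>\<infinity>i\<in>{m..}. norm (G_term q [Suc 0] z [[Suc i]]))"
      by (simp add: G_tails_one infsum_reindex[OF inj] o_def)
    also have "\<dots> \<le> (\<Sum>\<^sub>\<infinity>i\<in>{m..}. C * q ^ i)"
      using sum summable_on_geometric bound by (rule infsum_mono)
    finally show ?thesis
      by (simp add: infsum_cmult_right' infsum_geometric_atLeast)
  qed
  moreover have "(\<lambda>M. norm (G_term q [Suc 0] z M)) summable_on G_tails [Suc 0] m" for m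
    using sum by (simp add: G_tails_one summable_on_reindex[OF inj] o_def)
  ultimately show ?case
    by (intro exI[of _ "C / (1 - q)"]) auto
next
  case (comma k ks)
  then obtain K where K: "\<And>m. (\<lambda>M. norm (G_term q (k # ks) z M)) summable_on G_tails (k # ks) m"
    "\<And>m. infsum (\<lambda>M. norm (G_term q (k # ks) z M)) (G_tails (k # ks) m) \<le> K * q ^ m"
    by blast
  \<comment> \<open>The remaining tail starts above \<open>Suc m\<close>, which gains one more
    factor \<open>q\<close>.\<close>
  have K': "infsum (\<lambda>M. norm (G_term q (k # ks) z M)) (G_tails (k # ks) (Suc m)) \<le> K * q * q ^ m" for m
    using K(2)[of "Suc m"] by (simp add: mult_ac)
  have "(\<lambda>M. norm (G_term q (Suc 0 # k # ks) z M)) summable_on G_tails (Suc 0 # k # ks) m \<and>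
      infsum (\<lambda>M. norm (G_term q (Suc 0 # k # ks) z M)) (G_tails (Suc 0 # k # ks) m)
        \<le> 1 * (K * q) / (1 - q) * q ^ m" for m
    by (intro conjI infsum_fibred(1,2)[OF bij_betw_G_tails_comma, where g = "G_term q (k # ks) z"
        and w = "\<lambda>i. 1 / of_real (q_bracket q (Suc i))" and C = 1 and K = "K * q"] K(1) K' norm_inverse_q_bracket)
      (auto simp: G_term_comma)
  then show ?case
    by blast
next
  case (plus k ks)
  then obtain K where K: "\<And>m. (\<lambda>M. norm (G_term q (Suc k # ks) z M)) summable_on G_tails (Suc k # ks) m"
    "\<And>m. infsum (\<lambda>M. norm (G_term q (Suc k # ks) z M)) (G_tails (Suc k # ks) m) \<le> K * q ^ m"
    by blast
  have "(\<lambda>M. norm (G_term q (Suc (Suc k) # ks) z M)) summable_on G_tails (Suc (Suc k) # ks) m \<and>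
      infsum (\<lambda>M. norm (G_term q (Suc (Suc k) # ks) z M)) (G_tails (Suc (Suc k) # ks) m)
        \<le> 1 / (1 - q * norm z) * K / (1 - q) * q ^ m" for m
    by (intro conjI infsum_fibred(1,2)[OF bij_betw_G_tails_plus, where g = "G_term q (Suc k # ks) z"
        and w = "\<lambda>i. 1 / q_bracket_log q z (Suc i)" and C = "1 / (1 - q * norm z)" and K = K] K norm_inverse_q_bracket_log)
      (auto simp: G_term_plus_tails)
  then show ?case
    by blast
qed

lemma infsum_G_tails_comma:
  assumes "is_index (k # ks)"
  shows "(\<Sum>\<^sub>\<infinity>i\<in>{m..}. 1 / of_real (q_bracket q (Suc i)) *
      infsum (G_term q (k # ks) z) (G_tails (k # ks) (Suc i))) =
    infsum (G_term q (Suc 0 # k # ks) z) (G_tails (Suc 0 # k # ks) m)"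
proof -
  obtain K where K: "\<And>m. (\<lambda>M. norm (G_term q (k # ks) z M)) summable_on G_tails (k # ks) m"
    "\<And>m. infsum (\<lambda>M. norm (G_term q (k # ks) z M)) (G_tails (k # ks) m) \<le> K * q ^ m"
    using G_term_summable[OF assms] by blast
  have K': "infsum (\<lambda>M. norm (G_term q (k # ks) z M)) (G_tails (k # ks) (Suc m)) \<le> K * q * q ^ m" for m
    using K(2)[of "Suc m"] by (simp add: mult_ac)
  show ?thesis
    by (intro infsum_fibred(3)[OF bij_betw_G_tails_comma, where C = 1 and K = "K * q", symmetric]
        K(1) K' norm_inverse_q_bracket)
      (auto simp: G_term_comma)
qed

lemma infsum_G_tails_plus:
  assumes "is_index (Suc k # ks)"
  shows "(\<Sum>\<^sub>\<infinity>i\<in>{m..}. 1 / q_bracket_log q z (Suc i) *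
      infsum (G_term q (Suc k # ks) z) (G_tails (Suc k # ks) i)) =
    infsum (G_term q (Suc (Suc k) # ks) z) (G_tails (Suc (Suc k) # ks) m)"
proof -
  obtain K where K: "\<And>m. (\<lambda>M. norm (G_term q (Suc k # ks) z M)) summable_on G_tails (Suc k # ks) m"
    "\<And>m. infsum (\<lambda>M. norm (G_term q (Suc k # ks) z M)) (G_tails (Suc k # ks) m) \<le> K * q ^ m"
    using G_term_summable[OF assms] by blast
  show ?thesis
    by (intro infsum_fibred(3)[OF bij_betw_G_tails_plus, where C = "1 / (1 - q * norm z)" and K = K,
          symmetric] K norm_inverse_q_bracket_log)
      (auto simp: G_term_plus_tails)
qed

subsection \<open>Transport\<close>

text \<open>The reversal moves the front of \<open>k\<close>, where \<open>index_induct\<close>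
  acts, to the end of the index being dualized, hence to the outermost variable of
  \<open>F\<close>.\<close>

definition dual_coeff :: "nat list \<Rightarrow> nat \<Rightarrow> real" where
  "dual_coeff k = F_coeff q (hoffman_dual (rev k))"

lemma dual_coeff_one: "0 < n \<Longrightarrow> dual_coeff [Suc 0] n = q ^ n / q_bracket q n"
  by (simp add: dual_coeff_def hoffman_dual_one F_coeff_one)

lemma hoffman_dual_decomp: obtains ks k where "hoffman_dual l = ks @ [k]" "0 < k"
  using is_index_hoffman_dual[of l] by (cases "hoffman_dual l" rule: rev_cases) (auto simp: is_index_def)

lemma dual_coeff_comma:
  "dual_coeff (Suc 0 # k # ks) n = q ^ n / q_bracket q n * dual_coeff (k # ks) n"
proof -
  obtain ls l where l: "hoffman_dual (rev (k # ks)) = ls @ [l]"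
    by (rule hoffman_dual_decomp)
  then have "hoffman_dual (rev (Suc 0 # k # ks)) = ls @ [Suc l]"
    using hoffman_dual_append_one[OF _ l] by simp
  then show ?thesis
    unfolding dual_coeff_def l by (simp only: F_coeff_snoc_Suc)
qed

lemma dual_coeff_plus:
  assumes "0 < n"
  shows "dual_coeff (Suc (Suc k) # ks) n =
    q ^ n / q_bracket q n * (\<Sum>a = 1..n. dual_coeff (Suc k # ks) a / q ^ a)"
proof -
  obtain ls l where l: "hoffman_dual (rev (Suc k # ks)) = ls @ [l]" "0 < l"
    by (rule hoffman_dual_decomp)
  then have "hoffman_dual (rev (Suc (Suc k) # ks)) = ls @ [l, Suc 0]"
    by (simp add: hoffman_dual_append_Suc)
  then show ?thesis
    unfolding dual_coeff_def l(1) by (simp only: F_coeff_snoc_one[OF assms l(2) q(1)])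
qed

text \<open>Each step of the induction costs at most one further power of \<open>n\<close>, and a
  factor \<open>q ^ n\<close> survives. Multiplied by \<open>norm (P n)\<close>, this is a series
  covered by \<open>summable_P\<close>.\<close>

lemma dual_coeff_bounds:
  assumes "is_index k" "0 < n"
  shows "0 \<le> dual_coeff k n \<and> dual_coeff k n \<le> real n ^ sum_list k * q ^ n"
  using assms
proof (induction arbitrary: n rule: index_induct)
  case one
  have "q ^ n / q_bracket q n \<le> 1 * q ^ n"
    using q q_bracket_ge_1[OF q one] by (simp add: divide_le_eq)
  also have "\<dots> \<le> real n ^ sum_list [Suc 0] * q ^ n"
    using q one by (intro mult_right_mono) auto
  finally show ?case
    using q q_bracket_ge_1[OF q one] by (simp add: dual_coeff_one one)
next
  case (comma k ks)
  let ?c = "q ^ n / q_bracket q n"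
  have c: "0 \<le> ?c" "?c \<le> real n"
  proof -
    have "q ^ n / q_bracket q n \<le> 1 / 1"
      using q q_bracket_ge_1[OF q comma.prems] by (intro frac_le power_le_one) auto
    also have "\<dots> \<le> real n"
      using comma.prems by simp
    finally show "?c \<le> real n" .
    show "0 \<le> ?c"
      using q q_bracket_ge_1[OF q comma.prems] by simp
  qed
  have "?c * dual_coeff (k # ks) n \<le> real n * (real n ^ sum_list (k # ks) * q ^ n)"
    using comma.IH[OF comma.prems] c by (intro mult_mono) auto
  then show ?case
    using comma.IH[OF comma.prems] mult_nonneg_nonneg[OF c(1), of "dual_coeff (k # ks) n"]
    unfolding dual_coeff_comma by (simp add: mult.assoc)
next
  case (plus k ks)
  let ?c = "q ^ n / q_bracket q n"
  have c: "0 \<le> ?c" "?c \<le> q ^ n"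
    using q q_bracket_ge_1[OF q plus.prems] by (auto simp: divide_le_eq)
  \<comment> \<open>Division by \<open>q ^ a\<close> removes the exponential factor of the induction
    hypothesis; \<open>?c\<close> then provides the new \<open>q ^ n\<close>.\<close>
  have le: "dual_coeff (Suc k # ks) a / q ^ a \<le> real n ^ sum_list (Suc k # ks)" if "a \<in> {1..n}" for a
  proof -
    have "dual_coeff (Suc k # ks) a / q ^ a \<le> real a ^ sum_list (Suc k # ks)"
      using plus.IH[of a] that q by (simp add: divide_le_eq)
    also have "\<dots> \<le> real n ^ sum_list (Suc k # ks)"
      using that by (intro power_mono) auto
    finally show ?thesis .
  qed
  have "(\<Sum>a = 1..n. dual_coeff (Suc k # ks) a / q ^ a) \<le> real n * real n ^ sum_list (Suc k # ks)"
    using sum_bounded_above[OF le, of "{1..n}"] by simp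
  moreover have "0 \<le> (\<Sum>a = 1..n. dual_coeff (Suc k # ks) a / q ^ a)"
    using plus.IH q by (intro sum_nonneg) auto
  ultimately have "0 \<le> ?c * (\<Sum>a = 1..n. dual_coeff (Suc k # ks) a / q ^ a) \<and>
      ?c * (\<Sum>a = 1..n. dual_coeff (Suc k # ks) a / q ^ a) \<le>
      q ^ n * (real n * real n ^ sum_list (Suc k # ks))"
    using c q by (intro conjI mult_mono mult_nonneg_nonneg) auto
  then show ?case
    unfolding dual_coeff_plus[OF plus.prems] by (simp add: mult_ac)
qed

section \<open>Interchange of double sums\<close>

lemma infsum_swap_bounded:
  fixes h :: "nat \<Rightarrow> nat \<Rightarrow> complex"
  assumes "\<And>n i. n \<in> A \<Longrightarrow> norm (h n i) \<le> C * (real n ^ w * q ^ n * norm (P n)) * q ^ i"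
  shows "(\<Sum>\<^sub>\<infinity>n\<in>A. \<Sum>\<^sub>\<infinity>i\<in>B. h n i) = (\<Sum>\<^sub>\<infinity>i\<in>B. \<Sum>\<^sub>\<infinity>n\<in>A. h n i)"
proof (rule infsum_swap_banach)
  \<comment> \<open>The majorant is a summable sequence in \<open>n\<close> times a geometric one in
    \<open>i\<close>. The sign of \<open>C\<close> is arbitrary, hence the absolute value.\<close>
  let ?c = "\<lambda>(n, i). \<bar>C\<bar> * (real n ^ w * q ^ n * norm (P n)) * q ^ i"
  have "?c summable_on A \<times> B"
  proof (rule summable_on_SigmaI)
    show "((\<lambda>i. ?c (n, i)) has_sum \<bar>C\<bar> * (real n ^ w * q ^ n * norm (P n)) * infsum (\<lambda>i. q ^ i) B) B" for n
      using summable_on_geometric[of 1 B] by (simp add: has_sum_cmult_right)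
    show "(\<lambda>n. \<bar>C\<bar> * (real n ^ w * q ^ n * norm (P n)) * infsum (\<lambda>i. q ^ i) B) summable_on A"
      by (intro summable_on_cmult_left summable_on_cmult_right summable_P)
  qed (use q in auto)
  moreover have "norm (case x of (n, i) \<Rightarrow> h n i) \<le> ?c x" if x_in: "x \<in> A \<times> B" for x
  proof -
    obtain n i where x: "x = (n, i)" "n \<in> A"
      using x_in by auto
    have "C * (real n ^ w * q ^ n * norm (P n)) * q ^ i \<le> \<bar>C\<bar> * (real n ^ w * q ^ n * norm (P n)) * q ^ i"
      using q by (intro mult_right_mono) auto
    then show ?thesis
      using assms[of n i] x by simp
  qed
  ultimately have "(\<lambda>x. norm (case x of (n, i) \<Rightarrow> h n i)) summable_on A \<times> B"
    by (rule Infinite_Sum.abs_summable_on_comparison_test')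
  then show "(\<lambda>(n, i). h n i) summable_on A \<times> B"
    by (rule abs_summable_summable)
qed

text \<open>The inner sum has \<open>n\<close> terms under the same bound, which costs one power of
  \<open>n\<close>; \<open>summable_P\<close> admits every power.\<close>

lemma infsum_swap_triangle:
  fixes h :: "nat \<Rightarrow> nat \<Rightarrow> complex"
  assumes "\<And>n a. 1 \<le> a \<Longrightarrow> a \<le> n \<Longrightarrow> norm (h n a) \<le> real n ^ w * q ^ n * norm (P n)"
  shows "(\<Sum>\<^sub>\<infinity>n\<in>{1..}. \<Sum>a = 1..n. h n a) = (\<Sum>\<^sub>\<infinity>a\<in>{1..}. \<Sum>\<^sub>\<infinity>n\<in>{a..}. h n a)"
proof -
  let ?h = "\<lambda>x. h (fst x) (snd x)"
  let ?S = "SIGMA n:{1::nat..}. {1..n}"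
  let ?T = "SIGMA a:{1::nat..}. {a..}"
  let ?b = "\<lambda>x. real (fst x) ^ w * q ^ fst x * norm (P (fst x))"
  have "?b summable_on ?S"
  proof (rule summable_on_SigmaI)
    show "((\<lambda>a. ?b (n, a)) has_sum real n ^ Suc w * q ^ n * norm (P n)) {1..n}" for n
      using has_sum_finite[of "{1..n}" "\<lambda>a. ?b (n, a)"] by (simp add: mult.assoc)
    show "(\<lambda>n. real n ^ Suc w * q ^ n * norm (P n)) summable_on {1..}"
      by (rule summable_P)
  qed (use q in auto)
  moreover have "norm (?h x) \<le> ?b x" if "x \<in> ?S" for x
    using that assms by auto
  ultimately have "(\<lambda>x. norm (?h x)) summable_on ?S"
    by (rule Infinite_Sum.abs_summable_on_comparison_test')
  then have S: "?h summable_on ?S"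
    by (rule abs_summable_summable)
  have bij: "bij_betw prod.swap ?T ?S"
    by (rule bij_betw_byWitness[where f' = prod.swap]) (auto intro: order_trans)
  have T: "(\<lambda>x. ?h (prod.swap x)) summable_on ?T"
    using S summable_on_reindex_bij_betw[OF bij, of ?h] by simp
  have "(\<Sum>\<^sub>\<infinity>n\<in>{1..}. \<Sum>a = 1..n. h n a) = infsum ?h ?S"
    using infsum_Sigma_banach[OF S] by simp
  also have "\<dots> = infsum (\<lambda>x. ?h (prod.swap x)) ?T"
    by (rule infsum_reindex_bij_betw[OF bij, symmetric])
  also have "\<dots> = (\<Sum>\<^sub>\<infinity>a\<in>{1..}. \<Sum>\<^sub>\<infinity>n\<in>{a..}. h n a)"
    using infsum_Sigma_banach[OF T] by simp
  finally show ?thesis .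
qed

text \<open>The invariant of the transport. It has to hold for every \<open>m\<close>, because the
  induction hypothesis is applied with \<open>m\<close> replaced by the new summation index:
  \<open>Suc i\<close> after a comma, \<open>i\<close> after a plus.\<close>

lemma connected_sum:
  assumes "is_index k"
  shows "(\<Sum>\<^sub>\<infinity>n\<in>{1..}. of_real (dual_coeff k n) * conn n m) = - infsum (G_term q k z) (G_tails k m)"
  using assms
proof (induction arbitrary: m rule: index_induct)
  case one
  have "(\<Sum>\<^sub>\<infinity>n\<in>{1..}. of_real (dual_coeff [Suc 0] n) * conn n m) =
      (\<Sum>\<^sub>\<infinity>n\<in>{1..}. of_real (q ^ n / q_bracket q n) * conn n m)"
    by (intro infsum_cong) (simp add: dual_coeff_one)
  \<comment> \<open>The base case is \<open>conn_weak\<close> with \<open>a = 1\<close>: by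
    \<open>G_term_one_eq\<close> its summands are the negated final factors of
    \<open>G\<close>.\<close>
  also have "\<dots> = (\<Sum>\<^sub>\<infinity>i\<in>{m..}. - G_term q [Suc 0] z [[Suc i]])"
    by (simp only: conn_weak[OF zero_less_one] G_term_one_eq) simp
  also have "\<dots> = - infsum (G_term q [Suc 0] z) (G_tails [Suc 0] m)"
    unfolding G_tails_one by (subst infsum_reindex) (auto simp: inj_on_def o_def infsum_uminus)
  finally show ?case
    by simp
next
  case (comma k ks)
  let ?d = "\<lambda>n. of_real (dual_coeff (k # ks) n) :: complex"
  let ?w = "\<lambda>i. 1 / of_real (q_bracket q (Suc i)) :: complex"
  \<comment> \<open>The leading \<open>q\<close> comes from taking the connector at
    \<open>Suc i\<close>, which contributes \<open>q ^ Suc i\<close>.\<close>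
  have bound: "norm (?d n * (?w i * conn n (Suc i))) \<le>
      q * (real n ^ sum_list (k # ks) * q ^ n * norm (P n)) * q ^ i" if "n \<in> {1..}" for n i
  proof -
    have n: "0 < n" using that by simp
    have "norm (?d n) \<le> real n ^ sum_list (k # ks) * q ^ n"
      using dual_coeff_bounds[OF comma.hyps n] by simp
    then have "norm (?d n) * (norm (?w i) * norm (conn n (Suc i))) \<le>
        (real n ^ sum_list (k # ks) * q ^ n) * (1 * (q ^ Suc i * norm (P n)))"
      using norm_inverse_q_bracket[of "Suc i"] norm_conn_le_right[OF n, of "Suc i"] q
      by (intro mult_mono) auto
    then show ?thesis
      unfolding norm_mult by (simp add: mult_ac)
  qed
  have "(\<Sum>\<^sub>\<infinity>n\<in>{1..}. of_real (dual_coeff (Suc 0 # k # ks) n) * conn n m) =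
      (\<Sum>\<^sub>\<infinity>n\<in>{1..}. \<Sum>\<^sub>\<infinity>i\<in>{m..}. ?d n * (?w i * conn n (Suc i)))"
  proof (intro infsum_cong)
    fix n :: nat assume "n \<in> {1..}"
    then have n: "0 < n" by simp
    have "of_real (dual_coeff (Suc 0 # k # ks) n) * conn n m =
        ?d n * (of_real (q ^ n / q_bracket q n) * conn n m)"
      by (simp add: dual_coeff_comma)
    then show "of_real (dual_coeff (Suc 0 # k # ks) n) * conn n m =
        (\<Sum>\<^sub>\<infinity>i\<in>{m..}. ?d n * (?w i * conn n (Suc i)))"
      unfolding conn_strict[OF n] by (simp only: infsum_cmult_right')
  qed
  also have "\<dots> = (\<Sum>\<^sub>\<infinity>i\<in>{m..}. \<Sum>\<^sub>\<infinity>n\<in>{1..}. ?d n * (?w i * conn n (Suc i)))"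
    using bound by (rule infsum_swap_bounded)
  also have "\<dots> = (\<Sum>\<^sub>\<infinity>i\<in>{m..}. - (?w i * infsum (G_term q (k # ks) z) (G_tails (k # ks) (Suc i))))"
  proof (intro infsum_cong)
    fix i
    have "(\<Sum>\<^sub>\<infinity>n\<in>{1..}. ?d n * (?w i * conn n (Suc i))) =
        ?w i * (\<Sum>\<^sub>\<infinity>n\<in>{1..}. ?d n * conn n (Suc i))"
      unfolding infsum_cmult_right'[symmetric] by (simp only: mult.left_commute)
    then show "(\<Sum>\<^sub>\<infinity>n\<in>{1..}. ?d n * (?w i * conn n (Suc i))) =
        - (?w i * infsum (G_term q (k # ks) z) (G_tails (k # ks) (Suc i)))"
      by (simp only: comma.IH mult_minus_right)
  qed
  also have "\<dots> = - infsum (G_term q (Suc 0 # k # ks) z) (G_tails (Suc 0 # k # ks) m)"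
    by (simp only: infsum_uminus infsum_G_tails_comma[OF comma.hyps])
  finally show ?case
    by simp
next
  case (plus k ks)
  let ?d = "\<lambda>n. dual_coeff (Suc k # ks) n"
  let ?w = "\<lambda>i. 1 / q_bracket_log q z (Suc i)"
  let ?h = "\<lambda>n a. of_real (?d a / q ^ a) * (of_real (q ^ n / q_bracket q n) * conn n m)"
  let ?s = "sum_list (Suc k # ks)"
  have bound1: "norm (?h n a) \<le> real n ^ ?s * q ^ n * norm (P n)" if "1 \<le> a" "a \<le> n" for n a
  proof -
    have a: "0 < a" and n: "0 < n" using that by auto
    have "?d a / q ^ a \<le> real a ^ ?s"
      using dual_coeff_bounds[OF plus.hyps a] q by (simp add: divide_le_eq)
    also have "\<dots> \<le> real n ^ ?s"
      using that by (intro power_mono) auto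
    finally have 1: "norm (of_real (?d a / q ^ a) :: complex) \<le> real n ^ ?s"
      using dual_coeff_bounds[OF plus.hyps a] q unfolding norm_of_real by simp
    have 2: "norm (of_real (q ^ n / q_bracket q n) :: complex) \<le> q ^ n"
      using q q_bracket_ge_1[OF q n] unfolding norm_of_real by (simp add: divide_le_eq)
    have "norm (conn n m) \<le> q ^ m * norm (P n)"
      by (rule norm_conn_le_right[OF n])
    also have "\<dots> \<le> 1 * norm (P n)"
      using q by (intro mult_right_mono power_le_one) auto
    finally have "norm (conn n m) \<le> norm (P n)" 
      by simp
    then have "norm (?h n a) \<le> real n ^ ?s * (q ^ n * norm (P n))"
      unfolding norm_mult using 1 2 q by (intro mult_mono) auto
    then show ?thesis
      by (simp add: mult.assoc)
  qed
  have bound2: "norm (of_real (?d a) * (?w i * conn a i)) \<le>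
      1 / (1 - q * norm z) * (real a ^ ?s * q ^ a * norm (P a)) * q ^ i" if "a \<in> {1..}" for a i
  proof -
    have a: "0 < a" using that by simp
    have "norm (of_real (?d a) :: complex) \<le> real a ^ ?s * q ^ a"
      using dual_coeff_bounds[OF plus.hyps a] by simp
    then have "norm (of_real (?d a) :: complex) * (norm (?w i) * norm (conn a i)) \<le>
        (real a ^ ?s * q ^ a) * (1 / (1 - q * norm z) * (q ^ i * norm (P a)))"
      using norm_inverse_q_bracket_log[of "Suc i"] norm_conn_le_right[OF a, of i] q
        one_minus_bounds(2)[of 1]
      by (intro mult_mono) auto
    then show ?thesis
      unfolding norm_mult by (simp add: mult_ac)
  qed
  have "(\<Sum>\<^sub>\<infinity>n\<in>{1..}. of_real (dual_coeff (Suc (Suc k) # ks) n) * conn n m) =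
      (\<Sum>\<^sub>\<infinity>n\<in>{1..}. \<Sum>a = 1..n. ?h n a)"
    by (intro infsum_cong) (simp add: dual_coeff_plus sum_distrib_right sum_distrib_left mult_ac)
  \<comment> \<open>Summing first over the outermost variable \<open>n\<close> of \<open>F\<close>,
    with the next one \<open>a\<close> fixed, makes \<open>conn_weak\<close> applicable.\<close>
  also have "\<dots> = (\<Sum>\<^sub>\<infinity>a\<in>{1..}. \<Sum>\<^sub>\<infinity>n\<in>{a..}. ?h n a)"
    using bound1 by (rule infsum_swap_triangle)
  also have "\<dots> = (\<Sum>\<^sub>\<infinity>a\<in>{1..}. \<Sum>\<^sub>\<infinity>i\<in>{m..}. of_real (?d a) * (?w i * conn a i))"
  proof (intro infsum_cong)
    fix a :: nat assume "a \<in> {1..}"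
    then have a: "0 < a" by simp
    show "(\<Sum>\<^sub>\<infinity>n\<in>{a..}. ?h n a) = (\<Sum>\<^sub>\<infinity>i\<in>{m..}. of_real (?d a) * (?w i * conn a i))"
      \<comment> \<open>The \<open>q ^ a\<close> produced by \<open>conn_weak\<close> cancels the
        division by \<open>q ^ a\<close> from \<open>dual_coeff_plus\<close>.\<close>
      unfolding infsum_cmult_right' conn_weak[OF a]
      unfolding infsum_cmult_right'[symmetric] using q by simp
  qed
  also have "\<dots> = (\<Sum>\<^sub>\<infinity>i\<in>{m..}. \<Sum>\<^sub>\<infinity>a\<in>{1..}. of_real (?d a) * (?w i * conn a i))"
    using bound2 by (rule infsum_swap_bounded)
  also have "\<dots> = (\<Sum>\<^sub>\<infinity>i\<in>{m..}. - (?w i * infsum (G_term q (Suc k # ks) z) (G_tails (Suc k # ks) i)))"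
  proof (intro infsum_cong)
    fix i
    have "(\<Sum>\<^sub>\<infinity>a\<in>{1..}. of_real (?d a) * (?w i * conn a i)) =
        ?w i * (\<Sum>\<^sub>\<infinity>a\<in>{1..}. of_real (?d a) * conn a i)"
      unfolding infsum_cmult_right'[symmetric] by (simp only: mult.left_commute)
    then show "(\<Sum>\<^sub>\<infinity>a\<in>{1..}. of_real (?d a) * (?w i * conn a i)) =
        - (?w i * infsum (G_term q (Suc k # ks) z) (G_tails (Suc k # ks) i))"
      by (simp only: plus.IH mult_minus_right)
  qed
  also have "\<dots> = - infsum (G_term q (Suc (Suc k) # ks) z) (G_tails (Suc (Suc k) # ks) m)"
    by (simp only: infsum_uminus infsum_G_tails_plus[OF plus.hyps])
  finally show ?case
    by simp
qed

section \<open>\<open>F\<close> as a single series in its largest variable\<close>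

lemma F_term_eq:
  "F_term q k' z ms = of_real (F_weight q k' ms) * P (ms ! (length k' - 1))"
  by (simp add: F_term_def F_weight_def P_def Let_def)

lemma F_weight_nonneg:
  assumes "ms \<in> F_tuples (length k')" "k' \<noteq> []"
  shows "0 \<le> F_weight q k' ms"
proof -
  have "0 \<le> q_bracket q (ms ! a)" if "a < length k'" for a
  proof -
    have "0 < ms ! a"
      using assms(1) that by (simp add: F_tuples_def)
    then show ?thesis
      using q_bracket_ge_1[OF q, of "ms ! a"] by simp
  qed
  then have "0 \<le> q ^ i / q_bracket q (ms ! a) ^ j" if "a < length k'" for a i j
    using that q by simp
  then show ?thesis
    using assms(2) unfolding F_weight_def Let_def
    by (intro mult_nonneg_nonneg prod_nonneg) auto
qed

text \<open>The tuples are fibred over their last entry \<open>n\<close>, on which alone the factor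
  \<open>P n\<close> depends; absolute convergence justifies summing the finite fibres
  first.\<close>

lemma F_eq:
  assumes "is_index k"
  shows "F q (rev k) z = - (\<Sum>\<^sub>\<infinity>n\<in>{1..}. of_real (dual_coeff k n) * P n)"
proof -
  define k' where "k' = hoffman_dual (rev k)"
  obtain s where s: "length k' = Suc s" "k' \<noteq> []"
    using is_index_hoffman_dual[of "rev k"] by (cases k') (auto simp: is_index_def k'_def)
  let ?S = "SIGMA n:{1..}. F_tuples_last (Suc s) n"
  let ?f = "\<lambda>x. F_term q k' z (snd x)"
  have bij: "bij_betw snd ?S (F_tuples (Suc s))"
  proof (rule bij_betw_byWitness[where f' = "\<lambda>ms. (last ms, ms)"])
    have "0 < last ms" if "ms \<in> F_tuples (Suc s)" for ms
      using that by (cases ms rule: rev_cases) (auto simp: F_tuples_def)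
    then show "(\<lambda>ms. (last ms, ms)) ` F_tuples (Suc s) \<subseteq> ?S"
      by (auto simp: F_tuples_last_def Suc_le_eq)
  qed (auto simp: F_tuples_last_def)
  have f: "?f (n, ms) = of_real (F_weight q k' ms) * P n" "0 \<le> F_weight q k' ms"
    if "ms \<in> F_tuples_last (Suc s) n" for n ms
  proof -
    have "ms ! s = n"
      using that by (elim F_tuples_last_decomp) (auto simp: nth_append)
    then show "?f (n, ms) = of_real (F_weight q k' ms) * P n"
      by (simp add: F_term_eq s)
    show "0 \<le> F_weight q k' ms"
      using that s F_weight_nonneg[of ms k'] by (simp add: F_tuples_last_def)
  qed
  have coeff: "dual_coeff k n = (\<Sum>ms\<in>F_tuples_last (Suc s) n. F_weight q k' ms)" for n
    by (simp add: dual_coeff_def F_coeff_def s(1) flip: k'_def)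
  have "(\<lambda>x. norm (?f x)) summable_on ?S"
  proof (rule summable_on_SigmaI)
    fix n :: nat
    \<comment> \<open>Since the weights are nonnegative, the norms over one fibre add up to exactly
      \<open>dual_coeff k n * norm (P n)\<close>, so \<open>dual_coeff_bounds\<close> gives absolute
      convergence.\<close>
    have "norm (?f (n, ms)) = F_weight q k' ms * norm (P n)" if "ms \<in> F_tuples_last (Suc s) n" for ms
      using f[OF that] by (simp add: norm_mult)
    then have "(\<Sum>ms\<in>F_tuples_last (Suc s) n. norm (?f (n, ms))) = dual_coeff k n * norm (P n)"
      unfolding coeff sum_distrib_right by (rule sum.cong[OF refl])
    then show "((\<lambda>ms. norm (?f (n, ms))) has_sum dual_coeff k n * norm (P n)) (F_tuples_last (Suc s) n)"
      using has_sum_finite[OF finite_F_tuples_last, of "\<lambda>ms. norm (?f (n, ms))" s n] by simp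
  next
    show "(\<lambda>n. dual_coeff k n * norm (P n)) summable_on {1..}"
    proof (rule summable_on_comparison_test[OF summable_P[of "sum_list k"]])
      fix n :: nat assume "n \<in> {1..}"
      then show "dual_coeff k n * norm (P n) \<le> real n ^ sum_list k * q ^ n * norm (P n)"
          "0 \<le> dual_coeff k n * norm (P n)"
        using dual_coeff_bounds[OF assms, of n] by (auto intro: mult_right_mono)
    qed
  qed auto
  then have S: "?f summable_on ?S"
    by (rule abs_summable_summable)
  have "infsum (F_term q k' z) (F_tuples (Suc s)) = infsum ?f ?S"
    by (rule infsum_reindex_bij_betw[OF bij, symmetric])
  also have "\<dots> = (\<Sum>\<^sub>\<infinity>n\<in>{1..}. \<Sum>ms\<in>F_tuples_last (Suc s) n. ?f (n, ms))"
    using infsum_Sigma_banach[OF S] finite_F_tuples_last by simp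
  also have "\<dots> = (\<Sum>\<^sub>\<infinity>n\<in>{1..}. of_real (dual_coeff k n) * P n)"
    unfolding coeff of_real_sum sum_distrib_right
    by (intro infsum_cong sum.cong refl f(1))
  finally show ?thesis
    by (simp add: F_def s flip: k'_def)
qed

end

theorem theorem3p6:
  fixes q :: real and k :: "nat list" and z :: complex
  assumes "0 < q" and "q < 1"
    and "is_index k"
    and "norm z < 1 / q"
  shows "F q k z = G q (rev k) z"
proof -
  interpret kawashima q z
    by unfold_locales (use assms in auto)
  have k: "is_index (rev k)"
    using assms(3) by (simp add: is_index_def)
  show ?thesis
    \<comment> \<open>At \<open>m = 0\<close> the connector reduces to \<open>P n\<close>, and the
      tails are all tuples of \<open>G\<close> because their entries are positive.\<close>
    using F_eq[OF k] connected_sum[OF k, of 0] by (simp add: G_def G_tuples_eq_G_tails[OF k])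
qed

end
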